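(* Let $(u(x-ct,y),v(x-ct,y))$, with profile $(u,v)\in C^2(D_L)$ and wave speed $c\in\mathbb R$, be a traveling-wave solution of the $\beta$-plane equation in $D_L=\mathbb T_L\times[-d,d]$ with $v=0$ on $y=\pm d$. Assume that $\beta-\Delta u\neq0$ at every point of $D_L$ where $u=c$, and that one of the following conditions holds: (i) $\beta>0$, $c\in(u_{\min},u_{\max})$, and $\nabla u\neq0$ at every point of $D_L$ where $u=c$; (ii) $\beta=0$ and $c\in\mathrm{Ran}(u)$. Then $(u(x-ct,y),v(x-ct,y))$ is a shear flow.
   Context: Let $L,d>0$, $\mathbb T_L=\mathbb R/L\mathbb Z$, $D_L=\mathbb T_L\times[-d,d]$. For a constant $\beta\ge0$, the $\beta$-plane equation on $D_L$ is $$u_t+uu_x+vu_y-\beta yv=-P_x,\quad v_t+uv_x+vv_y+\beta yu=-P_y,\quad u_x+v_y=0,$$ with boundary condition $v=0$ on $y=\pm d$ ($P$ is the pressure). A traveling-wave solution of speed $c\in\mathbb R$ is a solution (for some pressure) of the form $(u(x-ct,y),v(x-ct,y))$; $(u,v)\in C^2(D_L)$ means that the profiles are $L$-periodic in the first variable and $C^2$ up to the boundary. It is a shear flow if $v\equiv0$ on $D_L$ (so that $u$ depends only on $y$). $u_{\max},u_{\min}$ are the maximum and minimum of $u$ over $D_L$, $\mathrm{Ran}(u)=[u_{\min},u_{\max}]$ is the range of $u$, and $\Delta=\partial_x^2+\partial_y^2$. *)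

theory Defs
  imports "HOL-Analysis.Analysis"
begin

text \<open>
  Functions on \<open>D\<^sub>L = \<real>/L\<int> \<times> [-d,d]\<close> are represented by their lifts to the strip
  \<open>\<real> \<times> [-d,d]\<close> that are \<open>L\<close>-periodic in the first variable; their values outside the strip
  are irrelevant.
\<close>

definition strip :: "real \<Rightarrow> (real \<times> real) set" where
  "strip d = UNIV \<times> {-d..d}"

definition x_periodic :: "real \<Rightarrow> real \<Rightarrow> (real \<times> real \<Rightarrow> real) \<Rightarrow> bool" where
  "x_periodic L d f \<longleftrightarrow> (\<forall>(x, y) \<in> strip d. f (x + L, y) = f (x, y))"

text \<open>
  Derivatives are taken within the closed strip, so on the boundary lines \<open>y = d\<close> and \<open>y = -d\<close>
  the derivative in \<open>y\<close> is one-sided. For \<open>d > 0\<close> the derivative within the strip is unique.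
\<close>

definition dx :: "real \<Rightarrow> (real \<times> real \<Rightarrow> real) \<Rightarrow> real \<times> real \<Rightarrow> real" where
  "dx d f z = frechet_derivative f (at z within strip d) (1, 0)"

definition dy :: "real \<Rightarrow> (real \<times> real \<Rightarrow> real) \<Rightarrow> real \<times> real \<Rightarrow> real" where
  "dy d f z = frechet_derivative f (at z within strip d) (0, 1)"

definition grad :: "real \<Rightarrow> (real \<times> real \<Rightarrow> real) \<Rightarrow> real \<times> real \<Rightarrow> real \<times> real" where
  "grad d f z = (dx d f z, dy d f z)"

definition laplacian :: "real \<Rightarrow> (real \<times> real \<Rightarrow> real) \<Rightarrow> real \<times> real \<Rightarrow> real" where
  "laplacian d f z = dx d (dx d f) z + dy d (dy d f) z"

primrec Ck_strip :: "real \<Rightarrow> nat \<Rightarrow> (real \<times> real \<Rightarrow> real) \<Rightarrow> bool" where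
  "Ck_strip d 0 f \<longleftrightarrow> continuous_on (strip d) f"
| "Ck_strip d (Suc k) f \<longleftrightarrow>
     f differentiable_on strip d \<and> Ck_strip d k (dx d f) \<and> Ck_strip d k (dy d f)"

definition Ck_DL :: "real \<Rightarrow> real \<Rightarrow> nat \<Rightarrow> (real \<times> real \<Rightarrow> real) \<Rightarrow> bool" where
  "Ck_DL L d k f \<longleftrightarrow> x_periodic L d f \<and> Ck_strip d k f"

text \<open>
  Time-dependent fields have type \<^typ>\<open>real \<Rightarrow> real \<times> real \<Rightarrow> real\<close>, with time first.
  The pressure may depend on time in an arbitrary way. It is a function on \<open>D\<^sub>L\<close>, hence
  \<open>L\<close>-periodic in \<open>x\<close>.
\<close>

definition beta_plane_solution ::
  "real \<Rightarrow> real \<Rightarrow> real \<Rightarrow> (real \<Rightarrow> real \<times> real \<Rightarrow> real) \<Rightarrow> (real \<Rightarrow> real \<times> real \<Rightarrow> real) \<Rightarrow> bool" where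
  "beta_plane_solution L d \<beta> u v \<longleftrightarrow>
     (\<forall>t. Ck_DL L d 1 (u t) \<and> Ck_DL L d 1 (v t)) \<and>
     (\<forall>t. \<forall>z\<in>strip d. (\<lambda>s. u s z) differentiable (at t) \<and> (\<lambda>s. v s z) differentiable (at t)) \<and>
     (\<exists>P :: real \<Rightarrow> real \<times> real \<Rightarrow> real.
        (\<forall>t. Ck_DL L d 1 (P t)) \<and>
        (\<forall>t. \<forall>(x, y)\<in>strip d.
           deriv (\<lambda>s. u s (x, y)) t + u t (x, y) * dx d (u t) (x, y) + v t (x, y) * dy d (u t) (x, y)
             - \<beta> * y * v t (x, y) = - dx d (P t) (x, y) \<and>
           deriv (\<lambda>s. v s (x, y)) t + u t (x, y) * dx d (v t) (x, y) + v t (x, y) * dy d (v t) (x, y)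
             + \<beta> * y * u t (x, y) = - dy d (P t) (x, y) \<and>
           dx d (u t) (x, y) + dy d (v t) (x, y) = 0)) \<and>
     (\<forall>t x. v t (x, d) = 0 \<and> v t (x, -d) = 0)"

definition traveling :: "real \<Rightarrow> (real \<times> real \<Rightarrow> real) \<Rightarrow> real \<Rightarrow> real \<times> real \<Rightarrow> real" where
  "traveling c f = (\<lambda>t (x, y). f (x - c * t, y))"

text \<open>That \<open>u\<close> depends only on \<open>y\<close> then follows from incompressibility, so \<open>u\<close> is not constrained here.\<close>

definition shear_flow ::
  "real \<Rightarrow> (real \<Rightarrow> real \<times> real \<Rightarrow> real) \<Rightarrow> (real \<Rightarrow> real \<times> real \<Rightarrow> real) \<Rightarrow> bool" where
  "shear_flow d u v \<longleftrightarrow> (\<forall>t. \<forall>z\<in>strip d. v t z = 0)"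

text \<open>
  For continuous \<open>x\<close>-periodic functions the supremum and infimum below are attained, so they are
  the maximum and the minimum over \<open>D\<^sub>L\<close>.
\<close>

definition u_max :: "real \<Rightarrow> (real \<times> real \<Rightarrow> real) \<Rightarrow> real" where
  "u_max d u = (SUP z\<in>strip d. u z)"

definition u_min :: "real \<Rightarrow> (real \<times> real \<Rightarrow> real) \<Rightarrow> real" where
  "u_min d u = (INF z\<in>strip d. u z)"

definition Ran :: "real \<Rightarrow> (real \<times> real \<Rightarrow> real) \<Rightarrow> real set" where
  "Ran d u = {u_min d u..u_max d u}"

end

theory Submission
  imports Defs
begin

text \<open>
  Put \<open>U = u - c\<close>. Taking the curl of the momentum equations in the moving frame gives
  \<open>U \<Delta>v = v (\<Delta>u - \<beta>)\<close>, that is \<open>div (U \<nabla>v - v \<nabla>U) = - \<beta> v\<close>. As \<open>\<beta> - \<Delta>u\<close> does not vanish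
  where \<open>U = 0\<close>, the quotient \<open>v / U\<close> is bounded. Testing with \<open>v / U\<close> (regularised near \<open>U = 0\<close>)
  over \<open>{U < 0}\<close> yields \<open>\<integral> \<bar>\<nabla>v - (v / U) \<nabla>U\<bar>\<^sup>2 - \<beta> v\<^sup>2 / U = 0\<close>, with both terms nonnegative.

  If \<open>\<beta> = 0\<close>, the same holds for \<open>-U\<close>, so \<open>U v\<^sub>x = v U\<^sub>x\<close> everywhere. With incompressibility this
  turns into \<open>(U v)\<^sub>x + (v\<^sup>2)\<^sub>y = 0\<close>, so \<open>\<integral> v\<^sup>2 dx\<close> does not depend on \<open>y\<close>. It vanishes on the walls.

  If \<open>\<beta> > 0\<close>, then \<open>v = 0\<close> where \<open>U < 0\<close>; there \<open>U\<^sub>x = - v\<^sub>y = 0\<close>, which makes \<open>U < 0\<close> on a whole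
  horizontal line. From such a line with \<open>v = v\<^sub>y = 0\<close>, \<open>v = 0\<close> spreads to the whole channel by unique
  continuation: \<open>U\<close> vanishes at most to first order on the line because \<open>\<nabla>u \<noteq> 0\<close> on \<open>{u = c}\<close>, hence
  \<open>\<bar>y - y\<^sub>1\<bar> \<bar>\<Delta>v\<bar> \<le> C \<bar>v\<bar>\<close> near \<open>y = y\<^sub>1\<close>, and such a singular potential is absorbed by a
  Carleman inequality with a weight depending on \<open>y\<close> only.
\<close>

subsection \<open>Partial derivatives and fluxes on strips\<close>

definition partial_x :: "real set \<Rightarrow> (real \<times> real \<Rightarrow> real) \<Rightarrow> (real \<times> real \<Rightarrow> real) \<Rightarrow> bool" where
  "partial_x I f f' \<longleftrightarrow> (\<forall>x. \<forall>y\<in>I. ((\<lambda>s. f (s, y)) has_real_derivative f' (x, y)) (at x))"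

definition partial_y :: "real set \<Rightarrow> (real \<times> real \<Rightarrow> real) \<Rightarrow> (real \<times> real \<Rightarrow> real) \<Rightarrow> bool" where
  "partial_y I f f' \<longleftrightarrow> (\<forall>x. \<forall>y\<in>I. ((\<lambda>s. f (x, s)) has_real_derivative f' (x, y)) (at y within I))"

lemma partial_xD:
  "partial_x I f f' \<Longrightarrow> y \<in> I \<Longrightarrow> ((\<lambda>s. f (s, y)) has_real_derivative f' (x, y)) (at x within S)"
  unfolding partial_x_def by (blast intro: has_field_derivative_at_within)

lemma partial_yD:
  "partial_y I f f' \<Longrightarrow> y \<in> I \<Longrightarrow> J \<subseteq> I \<Longrightarrow> ((\<lambda>s. f (x, s)) has_real_derivative f' (x, y)) (at y within J)"
  unfolding partial_y_def by (blast intro: has_field_derivative_subset)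

lemma real_derivative_unique_within_Icc:
  fixes f :: "real \<Rightarrow> real"
  assumes "a < b" "y \<in> {a..b}" "(f has_real_derivative D) (at y within {a..b})"
    "(f has_real_derivative E) (at y within {a..b})"
  shows "D = E"
  using vector_derivative_unique_within_closed_interval[of a b y f D E] assms
  by (simp add: has_real_derivative_iff_has_vector_derivative)

lemma continuous_on_slice_x:
  assumes "continuous_on (UNIV \<times> I) f" "y \<in> I"
  shows "continuous_on S (\<lambda>x. f (x, y))"
  by (rule continuous_on_compose2[OF assms(1)]) (use assms(2) in \<open>auto intro!: continuous_intros\<close>)

lemma continuous_on_slice_y:
  assumes "continuous_on (UNIV \<times> I) f" "S \<subseteq> I"
  shows "continuous_on S (\<lambda>y. f (x, y))"
  by (rule continuous_on_compose2[OF assms(1)]) (use assms(2) in \<open>auto intro!: continuous_intros\<close>)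

lemma integral_derivative_eq:
  fixes f :: "real \<Rightarrow> real"
  assumes "a \<le> b" "\<And>x. x \<in> {a..b} \<Longrightarrow> (f has_real_derivative f' x) (at x within {a..b})"
  shows "(f' has_integral (f b - f a)) {a..b}"
  using assms by (intro fundamental_theorem_of_calculus)
    (auto simp: has_real_derivative_iff_has_vector_derivative)

lemma flux_derivative:
  assumes "0 \<le> L" "partial_x {a..b} X Xx" "partial_y {a..b} Y Yy"
    and cY: "continuous_on (UNIV \<times> {a..b}) Y" and cYy: "continuous_on (UNIV \<times> {a..b}) Yy"
    and per: "\<And>y. y \<in> {a..b} \<Longrightarrow> X (L, y) = X (0, y)"
    and y: "y \<in> {a..b}"
  shows "((\<lambda>y. integral {0..L} (\<lambda>x. Y (x, y))) has_real_derivative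
      integral {0..L} (\<lambda>x. Xx (x, y) + Yy (x, y))) (at y within {a..b})"
proof -
  have "((\<lambda>y. integral (cbox 0 L) (\<lambda>x. Y (x, y))) has_real_derivative
      integral (cbox 0 L) (\<lambda>x. Yy (x, y))) (at y within {a..b})"
  proof (rule leibniz_rule_field_derivative[of "{a..b}" 0 L "\<lambda>y x. Y (x, y)" "\<lambda>y x. Yy (x, y)"])
    show "((\<lambda>y. Y (t, y)) has_real_derivative Yy (t, x)) (at x within {a..b})"
      if "x \<in> {a..b}" for x t
      using partial_yD[OF assms(3) that] by simp
    show "(\<lambda>t. Y (t, x)) integrable_on cbox 0 L" if "x \<in> {a..b}" for x
      using continuous_on_slice_x[OF cY that] by (rule integrable_continuous)
    show "continuous_on ({a..b} \<times> cbox 0 L) (\<lambda>(x, t). Yy (t, x))"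
      unfolding split_beta
      by (rule continuous_on_compose2[OF cYy]) (auto intro!: continuous_intros)
  qed (use y in auto)
  moreover have "((\<lambda>x. Xx (x, y)) has_integral 0) {0..L}"
    using integral_derivative_eq[OF assms(1) partial_xD[OF assms(2) y]] per[OF y] by simp
  moreover have "(\<lambda>x. Yy (x, y)) integrable_on {0..L}"
    using continuous_on_slice_x[OF cYy y] by (rule integrable_continuous_interval)
  ultimately show ?thesis
    by (simp add: integral_add has_integral_integrable integral_unique)
qed

lemma mixed_partials_eq:
  assumes "a < b" and fA: "partial_x {a..b} f A" and fB: "partial_y {a..b} f B"
    and AA: "partial_y {a..b} A Ay" and BB: "partial_x {a..b} B Bx"
    and cB: "continuous_on (UNIV \<times> {a..b}) B"
    and cAy: "continuous_on (UNIV \<times> {a..b}) Ay" and cBx: "continuous_on (UNIV \<times> {a..b}) Bx"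
    and y: "y \<in> {a..b}"
  shows "Ay (x, y) = Bx (x, y)"
proof -
  have eq: "integral {a..t} (\<lambda>s. Ay (x, s)) = integral {a..t} (\<lambda>s. Bx (x, s))" if t: "t \<in> {a..b}" for t
  proof -
    have sub: "{a..t} \<subseteq> {a..b}" and at: "a \<le> t" using t by auto
    have 1: "integral {a..t} (\<lambda>s. Ay (x, s)) = A (x, t) - A (x, a)"
      by (rule integral_unique, rule integral_derivative_eq[OF at])
        (use partial_yD[OF AA _ sub] sub in auto)
    have 2: "integral {a..t} (\<lambda>s. B (z, s)) = f (z, t) - f (z, a)" for z
      by (rule integral_unique, rule integral_derivative_eq[OF at])
        (use partial_yD[OF fB _ sub] sub in auto)
    have "((\<lambda>z. integral (cbox a t) (\<lambda>s. B (z, s))) has_real_derivative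
        integral (cbox a t) (\<lambda>s. Bx (x, s))) (at x within UNIV)"
    proof (rule leibniz_rule_field_derivative[of UNIV a t "\<lambda>z s. B (z, s)" "\<lambda>z s. Bx (z, s)"])
      show "((\<lambda>z. B (z, s)) has_real_derivative Bx (z, s)) (at z within UNIV)"
        if "s \<in> cbox a t" for s z
        using partial_xD[OF BB, of s z] sub that by auto
      show "(\<lambda>s. B (z, s)) integrable_on cbox a t" for z
        by (rule integrable_continuous, rule continuous_on_slice_y[OF cB]) (use sub in auto)
      show "continuous_on (UNIV \<times> cbox a t) (\<lambda>(z, s). Bx (z, s))"
        by (simp, rule continuous_on_subset[OF cBx]) (use sub in auto)
    qed auto
    then have "((\<lambda>z. f (z, t) - f (z, a)) has_real_derivative integral {a..t} (\<lambda>s. Bx (x, s))) (at x)"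
      by (simp add: 2)
    moreover have "((\<lambda>z. f (z, t) - f (z, a)) has_real_derivative A (x, t) - A (x, a)) (at x)"
      using partial_xD[OF fA] t by (intro DERIV_diff) auto
    ultimately show ?thesis using DERIV_unique 1 by metis
  qed
  have "((\<lambda>t. integral {a..t} (\<lambda>s. Ay (x, s))) has_real_derivative Ay (x, y)) (at y within {a..b})"
    by (rule integral_has_real_derivative[OF continuous_on_slice_y[OF cAy] y]) simp
  then have "((\<lambda>t. integral {a..t} (\<lambda>s. Bx (x, s))) has_real_derivative Ay (x, y)) (at y within {a..b})"
    by (rule has_field_derivative_transform_within[OF _ zero_less_one y]) (use eq in simp)
  moreover have "((\<lambda>t. integral {a..t} (\<lambda>s. Bx (x, s))) has_real_derivative Bx (x, y)) (at y within {a..b})"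
    by (rule integral_has_real_derivative[OF continuous_on_slice_y[OF cBx] y]) simp
  ultimately show ?thesis
    by (rule real_derivative_unique_within_Icc[OF \<open>a < b\<close> y])
qed

lemma strip_partials:
  assumes d: "d > 0" and f: "f differentiable_on strip d"
  shows "partial_x {-d..d} f (dx d f)" "partial_y {-d..d} f (dy d f)"
proof -
  have D: "(f has_derivative frechet_derivative f (at z within strip d)) (at z within strip d)"
    if "z \<in> strip d" for z
    using f that by (auto simp: differentiable_on_def frechet_derivative_works[symmetric])
  have lin: "frechet_derivative f (at z within strip d) (t *\<^sub>R w) =
      t * frechet_derivative f (at z within strip d) w" if "z \<in> strip d" for z t w
    using has_derivative_linear[OF D[OF that]] by (simp add: linear_cmul)
  show "partial_x {-d..d} f (dx d f)"
    unfolding partial_x_def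
  proof (intro allI ballI)
    fix x y :: real assume y: "y \<in> {-d..d}"
    have z: "(x, y) \<in> strip d" using y by (simp add: strip_def)
    have g: "((\<lambda>s. (s, y)) has_derivative (\<lambda>h. (h, 0))) (at x)"
      by (auto intro!: derivative_eq_intros)
    have "((\<lambda>s. f (s, y)) has_derivative
        (\<lambda>h. frechet_derivative f (at (x, y) within strip d) (h, 0))) (at x)"
      by (rule has_derivative_in_compose[OF g], rule has_derivative_subset[OF D[OF z]])
        (use y in \<open>auto simp: strip_def\<close>)
    moreover have "(\<lambda>h. frechet_derivative f (at (x, y) within strip d) (h, 0)) = (*) (dx d f (x, y))"
    proof
      show "frechet_derivative f (at (x, y) within strip d) (h, 0) = dx d f (x, y) * h" for h
        using lin[OF z, of h "(1, 0)"] by (simp add: dx_def mult.commute)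
    qed
    ultimately show "((\<lambda>s. f (s, y)) has_real_derivative dx d f (x, y)) (at x)"
      by (simp add: has_field_derivative_def)
  qed
  show "partial_y {-d..d} f (dy d f)"
    unfolding partial_y_def
  proof (intro allI ballI)
    fix x y :: real assume y: "y \<in> {-d..d}"
    have z: "(x, y) \<in> strip d" using y by (simp add: strip_def)
    have g: "((\<lambda>s. (x, s)) has_derivative (\<lambda>h. (0, h))) (at y within {-d..d})"
      by (auto intro!: derivative_eq_intros)
    have "((\<lambda>s. f (x, s)) has_derivative
        (\<lambda>h. frechet_derivative f (at (x, y) within strip d) (0, h))) (at y within {-d..d})"
      by (rule has_derivative_in_compose[OF g], rule has_derivative_subset[OF D[OF z]])
        (auto simp: strip_def)
    moreover have "(\<lambda>h. frechet_derivative f (at (x, y) within strip d) (0, h)) = (*) (dy d f (x, y))"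
    proof
      show "frechet_derivative f (at (x, y) within strip d) (0, h) = dy d f (x, y) * h" for h
        using lin[OF z, of h "(0, 1)"] by (simp add: dy_def mult.commute)
    qed
    ultimately show "((\<lambda>s. f (x, s)) has_real_derivative dy d f (x, y)) (at y within {-d..d})"
      by (simp add: has_field_derivative_def)
  qed
qed

lemma Ck_DL_Suc_D:
  assumes d: "d > 0" and f: "Ck_DL L d (Suc k) f"
  shows "Ck_DL L d k (dx d f)" "Ck_DL L d k (dy d f)"
proof -
  have diff: "f differentiable_on strip d" and "Ck_strip d k (dx d f)" "Ck_strip d k (dy d f)"
    and per: "\<And>x y. y \<in> {-d..d} \<Longrightarrow> f (x + L, y) = f (x, y)"
    using f by (auto simp: Ck_DL_def x_periodic_def strip_def)
  note P = strip_partials[OF d diff]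
  have "dx d f (x + L, y) = dx d f (x, y)" if y: "y \<in> {-d..d}" for x y
  proof -
    have "((\<lambda>s. f (s + L, y)) has_real_derivative dx d f (x + L, y)) (at x)"
      using DERIV_shift[THEN iffD1, OF partial_xD[OF P(1) y]] .
    then show ?thesis
      using partial_xD[OF P(1) y, of x UNIV] per[OF y] DERIV_unique by fastforce
  qed
  moreover have "dy d f (x + L, y) = dy d f (x, y)" if y: "y \<in> {-d..d}" for x y
  proof -
    have "((\<lambda>s. f (x, s)) has_real_derivative dy d f (x + L, y)) (at y within {-d..d})"
      by (rule has_field_derivative_transform_within[OF partial_yD[OF P(2) y order_refl] zero_less_one y])
        (use per in auto)
    then show ?thesis
      using real_derivative_unique_within_Icc[OF _ y _ partial_yD[OF P(2) y order_refl]] d by simp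
  qed
  ultimately show "Ck_DL L d k (dx d f)" "Ck_DL L d k (dy d f)"
    using \<open>Ck_strip d k (dx d f)\<close> \<open>Ck_strip d k (dy d f)\<close>
    by (auto simp: Ck_DL_def x_periodic_def strip_def)
qed

lemma Ck_strip_continuous: "Ck_strip d k f \<Longrightarrow> continuous_on (UNIV \<times> {-d..d}) f"
  by (cases k) (auto simp: strip_def differentiable_imp_continuous_on)

subsection \<open>Unique continuation across a horizontal line\<close>

text \<open>
  Conjugating \<open>\<Delta>\<close> with the weight \<open>exp (t (y - 2)\<^sup>2 / 2)\<close> splits it into a symmetric part \<open>S\<close> and a
  skew part \<open>K\<close>; below, \<open>q = t (y - 2)\<close> and \<open>w = v\<^sub>y + q v\<close>. The term \<open>2 v w / y - v\<^sup>2 / y\<^sup>2\<close>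
  comes from differentiating \<open>v\<^sup>2 / y\<close> (Hardy's inequality); it absorbs the potential \<open>C / y\<close>.
\<close>

lemma carleman_pointwise:
  fixes v w D S K E q t C y :: real
  assumes "S + K = D" "y > 0" "\<bar>y * D\<bar> \<le> C * \<bar>v\<bar>" "C\<^sup>2 \<le> t" "t\<^sup>2 \<le> q\<^sup>2" "0 \<le> t" "0 \<le> E"
  shows "E * (2 * S * K - 4 * t * w\<^sup>2 - 4 * t * q\<^sup>2 * v\<^sup>2) + 2 * C\<^sup>2 * (E * (2 * v * w / y - v\<^sup>2 / y\<^sup>2))
    \<le> - (4 * t ^ 3) * (E * v\<^sup>2)"
proof -
  have "2 * S * K \<le> (S + K)\<^sup>2"
    using sum_squares_ge_zero[of S K] by (simp add: power2_eq_square algebra_simps)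
  also have "(S + K)\<^sup>2 \<le> C\<^sup>2 * (v / y)\<^sup>2"
  proof -
    have "\<bar>D\<bar> \<le> \<bar>C * (v / y)\<bar>"
      using assms(2,3) by (simp add: abs_mult abs_divide field_simps)
        (metis abs_ge_self abs_ge_zero mult_right_mono order.trans)
    then show ?thesis
      unfolding assms(1) by (metis abs_le_square_iff power_mult_distrib)
  qed
  finally have "2 * S * K \<le> C\<^sup>2 * (v / y)\<^sup>2" .
  moreover have "C\<^sup>2 * (v / y - 2 * w)\<^sup>2 \<ge> 0" by simp
  then have "4 * (C\<^sup>2 * (v / y * w)) - C\<^sup>2 * (v / y)\<^sup>2 \<le> 4 * (C\<^sup>2 * w\<^sup>2)"
    by (simp add: power2_eq_square algebra_simps)
  moreover have "C\<^sup>2 * w\<^sup>2 \<le> t * w\<^sup>2" using assms(4) by (rule mult_right_mono) simp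
  moreover have "t * t\<^sup>2 * v\<^sup>2 \<le> t * q\<^sup>2 * v\<^sup>2"
    using assms(5,6) by (intro mult_right_mono mult_left_mono) auto
  ultimately have "2 * S * K - 4 * (t * w\<^sup>2) - 4 * (t * q\<^sup>2 * v\<^sup>2) + 4 * (C\<^sup>2 * (v / y * w))
      - 2 * (C\<^sup>2 * (v / y)\<^sup>2) \<le> - 4 * (t * t\<^sup>2 * v\<^sup>2)"
    by linarith
  from mult_left_mono[OF this \<open>0 \<le> E\<close>] show ?thesis
    by (simp add: algebra_simps power_divide power3_eq_cube power2_eq_square)
qed

lemma unique_continuation_half_strip:
  fixes v vx vy vxx vxy vyy :: "real \<times> real \<Rightarrow> real"
  assumes L: "L > 0" and \<delta>: "0 < \<delta>" "\<delta> \<le> 1"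
    and px: "partial_x {0..\<delta>} v vx" "partial_x {0..\<delta>} vx vxx" "partial_x {0..\<delta>} vy vxy"
    and py: "partial_y {0..\<delta>} v vy" "partial_y {0..\<delta>} vx vxy" "partial_y {0..\<delta>} vy vyy"
    and c: "continuous_on (UNIV \<times> {0..\<delta>}) v" "continuous_on (UNIV \<times> {0..\<delta>}) vx"
      "continuous_on (UNIV \<times> {0..\<delta>}) vy" "continuous_on (UNIV \<times> {0..\<delta>}) vxx"
      "continuous_on (UNIV \<times> {0..\<delta>}) vxy" "continuous_on (UNIV \<times> {0..\<delta>}) vyy"
    and per: "\<And>y. y \<in> {0..\<delta>} \<Longrightarrow> v (L, y) = v (0, y)" "\<And>y. y \<in> {0..\<delta>} \<Longrightarrow> vx (L, y) = vx (0, y)"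
      "\<And>y. y \<in> {0..\<delta>} \<Longrightarrow> vy (L, y) = vy (0, y)"
    and bound: "\<And>x y. x \<in> {0..L} \<Longrightarrow> y \<in> {0..\<delta>} \<Longrightarrow> \<bar>y * (vxx (x, y) + vyy (x, y))\<bar> \<le> C * \<bar>v (x, y)\<bar>"
    and zero: "\<And>x. v (x, 0) = 0" "\<And>x. vy (x, 0) = 0"
    and xy: "x \<in> {0..L}" "y \<in> {0..<\<delta>}"
  shows "v (x, y) = 0"
proof -
  have vx0: "vx (x, 0) = 0" for x
    using DERIV_unique[OF partial_xD[OF px(1), of 0 x UNIV], of 0] \<delta> by (simp add: zero)
  obtain M where M: "M \<ge> 0" "\<And>x y. x \<in> {0..L} \<Longrightarrow> y \<in> {0..\<delta>} \<Longrightarrow> \<bar>v (x, y)\<bar> \<le> M \<and> \<bar>vx (x, y)\<bar> \<le> M \<and> \<bar>vy (x, y)\<bar> \<le> M"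
  proof -
    have cpt: "compact ({0..L} \<times> {0..\<delta>})" by (intro compact_Times compact_Icc)
    have "\<exists>m. \<forall>z\<in>{0..L} \<times> {0..\<delta>}. \<bar>f z\<bar> \<le> m" if "continuous_on (UNIV \<times> {0..\<delta>}) f" for f :: "real \<times> real \<Rightarrow> real"
    proof -
      have "compact (f ` ({0..L} \<times> {0..\<delta>}))"
        by (rule compact_continuous_image[OF continuous_on_subset[OF that] cpt]) auto
      then have "bounded (f ` ({0..L} \<times> {0..\<delta>}))" by (rule compact_imp_bounded)
      then show ?thesis unfolding bounded_iff by (metis imageI real_norm_def)
    qed
    from this[OF c(1)] this[OF c(2)] this[OF c(3)] obtain m1 m2 m3 where
      "\<forall>z\<in>{0..L} \<times> {0..\<delta>}. \<bar>v z\<bar> \<le> m1" "\<forall>z\<in>{0..L} \<times> {0..\<delta>}. \<bar>vx z\<bar> \<le> m2"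
      "\<forall>z\<in>{0..L} \<times> {0..\<delta>}. \<bar>vy z\<bar> \<le> m3" by auto
    then have "\<bar>v (x, y)\<bar> \<le> m1" "\<bar>vx (x, y)\<bar> \<le> m2" "\<bar>vy (x, y)\<bar> \<le> m3"
      if "x \<in> {0..L}" "y \<in> {0..\<delta>}" for x y
      using that by blast+
    then show ?thesis by (intro that[of "max 0 (max m1 (max m2 m3))"]) (simp_all add: le_max_iff_disj)
  qed
  have vlin: "\<bar>v (x, y)\<bar> \<le> M * y" if x: "x \<in> {0..L}" and y: "y \<in> {0..\<delta>}" for x y
  proof -
    have "\<exists>z\<in>{0..y}. v (x, y) - v (x, 0) = (*) (vy (x, z)) (y - 0)"
      using y by (intro mvt_very_simple)
        (auto intro!: partial_yD[OF py(1), unfolded has_field_derivative_def])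
    then obtain z where z: "z \<in> {0..y}" "v (x, y) = vy (x, z) * y" by (auto simp: zero)
    have "\<bar>vy (x, z)\<bar> * \<bar>y\<bar> \<le> M * \<bar>y\<bar>"
      using M(2)[OF x, of z] z(1) y by (intro mult_right_mono) auto
    then show ?thesis using z y by (simp add: abs_mult)
  qed
  define H where "H y = integral {0..L} (\<lambda>x. (v (x, y))\<^sup>2)" for y
  have intv: "(\<lambda>x. (v (x, y))\<^sup>2) integrable_on {0..L}" if "y \<in> {0..\<delta>}" for y
    by (intro integrable_continuous_interval continuous_intros continuous_on_slice_x[OF c(1) that])
  have H0: "H y \<ge> 0" if "y \<in> {0..\<delta>}" for y
    unfolding H_def by (rule integral_nonneg[OF intv[OF that]]) simp
  define E where "E t y = exp (t * (y - 2)\<^sup>2)" for t y :: real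
  define g where "g t = (\<lambda>(x, y). vy (x, y) + t * (y - 2) * v (x, y))" for t
  define B where "B t = (\<lambda>(x, y). E t y * (- 2 * (t * (y - 2)) * (g t (x, y))\<^sup>2 + 2 * (t * (y - 2)) * (vx (x, y))\<^sup>2
      - 2 * (t * (y - 2)) ^ 3 * (v (x, y))\<^sup>2 - 2 * t * v (x, y) * g t (x, y)))" for t
  define B' where "B' t = (\<lambda>(x, y). 2 * (t * (y - 2)) * B t (x, y) + E t y * (
      - 2 * t * (g t (x, y))\<^sup>2 - 4 * (t * (y - 2)) * g t (x, y) * (vyy (x, y) + t * v (x, y) + t * (y - 2) * vy (x, y))
      + 2 * t * (vx (x, y))\<^sup>2 + 4 * (t * (y - 2)) * vx (x, y) * vxy (x, y)
      - 6 * t * (t * (y - 2))\<^sup>2 * (v (x, y))\<^sup>2 - 4 * (t * (y - 2)) ^ 3 * v (x, y) * vy (x, y)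
      - 2 * t * vy (x, y) * g t (x, y)
      - 2 * t * v (x, y) * (vyy (x, y) + t * v (x, y) + t * (y - 2) * vy (x, y))))" for t
  define X where "X t = (\<lambda>(x, y). - E t y * (4 * (t * (y - 2)) * vx (x, y) * g t (x, y) + 2 * t * v (x, y) * vx (x, y)))" for t
  define X' where "X' t = (\<lambda>(x, y). - E t y * (4 * (t * (y - 2)) * vxx (x, y) * g t (x, y)
      + 4 * (t * (y - 2)) * vx (x, y) * (vxy (x, y) + t * (y - 2) * vx (x, y))
      + 2 * t * (vx (x, y))\<^sup>2 + 2 * t * v (x, y) * vxx (x, y)))" for t
  define G where "G t = (\<lambda>(x, y). B t (x, y) + 2 * C\<^sup>2 * (E t y * (v (x, y))\<^sup>2 / y))" for t
  define G' where "G' t = (\<lambda>(x, y). B' t (x, y)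
      + 2 * C\<^sup>2 * (E t y * (2 * v (x, y) * g t (x, y) / y - (v (x, y))\<^sup>2 / y\<^sup>2)))" for t
  have E': "(E t has_real_derivative 2 * (t * (y - 2)) * E t y) (at y within S)" for t y S
    unfolding E_def by (auto intro!: derivative_eq_intros)
  have gx: "((\<lambda>s. g t (s, y)) has_real_derivative vxy (x, y) + t * (y - 2) * vx (x, y)) (at x)"
    if "y \<in> {0..\<delta>}" for t x y
    unfolding g_def split_conv
    by (rule derivative_eq_intros partial_xD[OF px(1) that] partial_xD[OF px(3) that] refl)+ simp
  have gy: "((\<lambda>s. g t (x, s)) has_real_derivative
      vyy (x, y) + t * v (x, y) + t * (y - 2) * vy (x, y)) (at y within {0..\<delta>})"
    if "y \<in> {0..\<delta>}" for t x y
    unfolding g_def split_conv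
    by (rule derivative_eq_intros partial_yD[OF py(1) that order_refl] partial_yD[OF py(3) that order_refl] refl)+
      (simp add: algebra_simps)
  have pX: "partial_x {0..\<delta>} (X t) (X' t)" for t
    unfolding partial_x_def
  proof (intro allI ballI)
    fix x y assume y: "y \<in> {0..\<delta>}"
    show "((\<lambda>s. X t (s, y)) has_real_derivative X' t (x, y)) (at x)"
      unfolding X_def X'_def split_conv
      by (rule derivative_eq_intros partial_xD[OF px(1) y] partial_xD[OF px(2) y] gx[OF y] refl)+
        (simp add: algebra_simps power2_eq_square)
  qed
  have pB: "partial_y {0..\<delta>} (B t) (B' t)" for t
    unfolding partial_y_def
  proof (intro allI ballI)
    fix x y assume y: "y \<in> {0..\<delta>}"
    show "((\<lambda>s. B t (x, s)) has_real_derivative B' t (x, y)) (at y within {0..\<delta>})"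
      unfolding B_def B'_def split_conv
      by (rule derivative_eq_intros partial_yD[OF py(1) y order_refl] partial_yD[OF py(2) y order_refl] gy[OF y] E' refl)+
        (simp add: algebra_simps power2_eq_square power3_eq_cube)
  qed
  have pG: "partial_y {a..\<delta>} (G t) (G' t)" if "a > 0" for t a
    unfolding partial_y_def
  proof (intro allI ballI)
    fix x y assume y: "y \<in> {a..\<delta>}"
    have B: "((\<lambda>y. B t (x, y)) has_real_derivative B' t (x, y)) (at y within {a..\<delta>})"
      using y that by (intro partial_yD[OF pB]) auto
    have V: "((\<lambda>y. v (x, y)) has_real_derivative vy (x, y)) (at y within {a..\<delta>})"
      using y that by (intro partial_yD[OF py(1)]) auto
    have "((\<lambda>y. E t y * (v (x, y))\<^sup>2 / y) has_real_derivative
        E t y * (2 * v (x, y) * g t (x, y) / y - (v (x, y))\<^sup>2 / y\<^sup>2)) (at y within {a..\<delta>})"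
      by (rule DERIV_cong[OF DERIV_divide[OF DERIV_mult[OF E' DERIV_power[OF V, of 2]] DERIV_ident]])
        (use y that in \<open>auto simp: g_def field_simps power2_eq_square\<close>)
    then show "((\<lambda>y. G t (x, y)) has_real_derivative G' t (x, y)) (at y within {a..\<delta>})"
      unfolding G_def G'_def split_conv by (intro DERIV_add B DERIV_cmult)
  qed
  \<comment> \<open>The flux \<open>(X, B)\<close> is chosen so that its divergence is the commutator \<open>2 S K - 4 t w\<^sup>2 - 4 t q\<^sup>2 v\<^sup>2\<close>.\<close>
  have key: "X' t (x, y) + G' t (x, y) \<le> - (4 * t ^ 3) * (E t y * (v (x, y))\<^sup>2)"
    if "x \<in> {0..L}" "y \<in> {0<..\<delta>}" "C\<^sup>2 \<le> t" "0 \<le> t" for x y t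
  proof -
    have "1 \<le> (2 - y)\<^sup>2"
      using that \<delta> by (intro one_le_power) auto
    then have "t\<^sup>2 * 1 \<le> t\<^sup>2 * (y - 2)\<^sup>2"
      by (intro mult_left_mono) (auto simp: power2_commute)
    then have q: "t\<^sup>2 \<le> (t * (y - 2))\<^sup>2" by (simp add: power_mult_distrib)
    let ?S = "vyy (x, y) + 2 * (t * (y - 2)) * vy (x, y) + (t + (t * (y - 2))\<^sup>2) * v (x, y) + vxx (x, y) + (t * (y - 2))\<^sup>2 * v (x, y)"
    let ?K = "- 2 * (t * (y - 2)) * g t (x, y) - t * v (x, y)"
    have SK: "?S + ?K = vxx (x, y) + vyy (x, y)"
      by (simp add: g_def algebra_simps power2_eq_square)
    have vy: "vy (x, y) = g t (x, y) - t * (y - 2) * v (x, y)" by (simp add: g_def)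
    have "X' t (x, y) + B' t (x, y) = E t y * (2 * ?S * ?K - 4 * t * (g t (x, y))\<^sup>2 - 4 * t * (t * (y - 2))\<^sup>2 * (v (x, y))\<^sup>2)"
      unfolding X'_def B'_def B_def split_conv vy
      by (simp add: algebra_simps power2_eq_square power3_eq_cube)
    have y: "0 < y" using that by simp
    have "\<bar>y * (vxx (x, y) + vyy (x, y))\<bar> \<le> C * \<bar>v (x, y)\<bar>" using that by (intro bound) auto
    note carleman_pointwise[OF SK y this that(3) q that(4), of "E t y" "g t (x, y)"]
    then show ?thesis
      using \<open>X' t (x, y) + B' t (x, y) = _\<close> by (simp add: G'_def E_def)
  qed
  define \<Phi> where "\<Phi> t y = integral {0..L} (\<lambda>x. G t (x, y))" for t y
  define \<Phi>' where "\<Phi>' t y = integral {0..L} (\<lambda>x. X' t (x, y) + G' t (x, y))" for t y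
  have cE: "continuous_on A (\<lambda>z. E t (f z))" if "continuous_on A f" for A t and f :: "real \<times> real \<Rightarrow> real"
    unfolding E_def by (intro continuous_intros that)
  have cB: "continuous_on (UNIV \<times> {0..\<delta>}) (B t)" "continuous_on (UNIV \<times> {0..\<delta>}) (B' t)"
    "continuous_on (UNIV \<times> {0..\<delta>}) (X' t)" for t
    unfolding B_def B'_def X'_def g_def split_beta prod.collapse
    by (intro continuous_intros cE c)+
  have cG: "continuous_on (UNIV \<times> {a..\<delta>}) (G t)" "continuous_on (UNIV \<times> {a..\<delta>}) (G' t)"
    if "a > 0" for a t
  proof -
    have sub: "UNIV \<times> {a..\<delta>} \<subseteq> (UNIV :: real set) \<times> {0..\<delta>}" using that by auto
    note [continuous_intros] = cB[THEN continuous_on_subset, OF sub] c[THEN continuous_on_subset, OF sub]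
    show "continuous_on (UNIV \<times> {a..\<delta>}) (G t)" "continuous_on (UNIV \<times> {a..\<delta>}) (G' t)"
      unfolding G_def G'_def g_def split_beta prod.collapse
      using that by (intro continuous_intros cE; auto)+
  qed
  have \<Phi>': "(\<Phi> t has_real_derivative \<Phi>' t y) (at y within {a..\<delta>})" if "a > 0" "y \<in> {a..\<delta>}" for a t y
    unfolding \<Phi>_def \<Phi>'_def
  proof (rule flux_derivative)
    show "partial_x {a..\<delta>} (X t) (X' t)"
      using pX \<open>a > 0\<close> by (auto simp: partial_x_def)
    show "X t (L, y) = X t (0, y)" if "y \<in> {a..\<delta>}" for y
      using per[of y] that \<open>a > 0\<close> by (simp add: X_def g_def)
  qed (use L that pG cG in auto)
  have decr: "\<Phi> t b - \<Phi> t a \<le> (b - a) * - (4 * t ^ 3 * E t b * \<eta>)"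
    if ab: "0 < a" "a < b" "b \<le> \<delta>" and t: "C\<^sup>2 \<le> t" "0 \<le> t" and \<eta>: "0 \<le> \<eta>" "\<And>y. y \<in> {a..b} \<Longrightarrow> \<eta> \<le> H y"
    for a b t \<eta>
  proof -
    have "\<exists>z\<in>{a<..<b}. \<Phi> t b - \<Phi> t a = (*) (\<Phi>' t z) (b - a)"
      by (rule mvt_simple[OF ab(2)], unfold has_field_derivative_def[symmetric])
        (rule has_field_derivative_subset[OF \<Phi>'[OF ab(1)]], use ab in auto)
    then obtain z where z: "z \<in> {a<..<b}" "\<Phi> t b - \<Phi> t a = \<Phi>' t z * (b - a)" by auto
    have z\<delta>: "z \<in> {0..\<delta>}" and za: "z \<in> {a..\<delta>}" and z0: "z \<in> {0<..\<delta>}" using z ab by auto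
    have "\<Phi>' t z \<le> integral {0..L} (\<lambda>x. - (4 * t ^ 3) * (E t z * (v (x, z))\<^sup>2))"
      unfolding \<Phi>'_def
      by (intro integral_le integrable_continuous_interval continuous_intros continuous_on_slice_x[OF cB(3) z\<delta>]
          continuous_on_slice_x[OF cG(2)[OF ab(1)] za] continuous_on_slice_x[OF c(1) z\<delta>] key z0 t) auto
    also have "\<dots> = - (4 * t ^ 3) * E t z * H z"
      by (simp add: H_def mult.assoc[symmetric])
    also have "\<dots> \<le> - (4 * t ^ 3 * E t b * \<eta>)"
    proof -
      have "(b - 2)\<^sup>2 \<le> (z - 2)\<^sup>2"
        using z ab \<delta> by (intro abs_le_square_iff[THEN iffD1]) auto
      then have "E t b \<le> E t z" unfolding E_def using t by (simp add: mult_left_mono)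
      then have "4 * t ^ 3 * (E t b * \<eta>) \<le> 4 * t ^ 3 * (E t z * H z)"
        using \<eta>(1) \<eta>(2)[of z] z t by (intro mult_left_mono mult_mono) (auto simp: E_def)
      then show ?thesis by (simp add: mult.assoc)
    qed
    finally have "\<Phi>' t z * (b - a) \<le> - (4 * t ^ 3 * E t b * \<eta>) * (b - a)"
      using ab by (intro mult_right_mono) auto
    then show ?thesis using z(2) by (simp add: mult.commute)
  qed
  have \<Phi>_le: "\<Phi> t a \<le> 0" if a: "0 < a" "a < \<delta>" and t: "C\<^sup>2 \<le> t" "0 \<le> t" for a t
  proof (rule ccontr)
    assume neg: "\<not> \<Phi> t a \<le> 0"
    define R where "R s = integral {0..L} (\<lambda>x. B t (x, s)) + 2 * C\<^sup>2 * (E t 0 * M\<^sup>2 * s * L)" for s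
    have R0: "R 0 = 0"
      by (simp add: R_def B_def g_def zero vx0)
    have cR: "continuous_on {0..\<delta>} R"
    proof -
      have "((\<lambda>y. integral {0..L} (\<lambda>x. B t (x, y))) has_real_derivative
          integral {0..L} (\<lambda>x. 0 + B' t (x, y))) (at y within {0..\<delta>})" if "y \<in> {0..\<delta>}" for y
        by (rule flux_derivative[of L 0 \<delta> "\<lambda>_. 0" "\<lambda>z. 0", OF _ _ pB cB(1,2) _ that]) (use L in \<open>auto simp: partial_x_def\<close>)
      then have "continuous_on {0..\<delta>} (\<lambda>y. integral {0..L} (\<lambda>x. B t (x, y)))"
        by (rule DERIV_continuous_on)
      then show ?thesis unfolding R_def by (intro continuous_intros)
    qed
    have "0 \<in> {0..\<delta>}" "0 < \<Phi> t a" using neg \<delta> by auto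
    from cR[unfolded continuous_on_iff, rule_format, OF this] obtain r where r: "r > 0" "\<And>s. s \<in> {0..\<delta>} \<Longrightarrow> dist s 0 < r \<Longrightarrow> dist (R s) (R 0) < \<Phi> t a"
      by blast
    define s where "s = min (a / 2) (r / 2)"
    have s: "0 < s" "s < a" "s < r" using a r(1) by (auto simp: s_def)
    have s\<delta>: "s \<in> {0..\<delta>}" using s a by auto
    have "\<Phi> t a \<le> \<Phi> t s" using decr[of s a t 0] s a t H0 by auto
    also have "\<dots> \<le> R s"
    proof -
      have le: "E t s * (v (x, s))\<^sup>2 / s \<le> E t 0 * M\<^sup>2 * s" if "x \<in> {0..L}" for x
      proof -
        have "(v (x, s))\<^sup>2 \<le> (M * s)\<^sup>2"
          using vlin[OF that s\<delta>] M(1) s by (intro abs_le_square_iff[THEN iffD1]) auto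
        moreover have "(s - 2)\<^sup>2 \<le> (0 - 2)\<^sup>2"
          using s a \<delta> by (intro abs_le_square_iff[THEN iffD1]) auto
        then have "E t s \<le> E t 0" unfolding E_def using t(2) by (simp add: mult_left_mono)
        ultimately have "E t s * (v (x, s))\<^sup>2 \<le> E t 0 * (M * s)\<^sup>2"
          by (intro mult_mono) (auto simp: E_def)
        then show ?thesis using s by (simp add: field_simps power2_eq_square)
      qed
      have "\<Phi> t s \<le> integral {0..L} (\<lambda>x. B t (x, s) + 2 * C\<^sup>2 * (E t 0 * M\<^sup>2 * s))"
        unfolding \<Phi>_def
      proof (rule integral_le)
        show "(\<lambda>x. G t (x, s)) integrable_on {0..L}"
          by (intro integrable_continuous_interval continuous_on_slice_x[OF cG(1)[OF s(1)]]) (use s a in auto)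
        show "(\<lambda>x. B t (x, s) + 2 * C\<^sup>2 * (E t 0 * M\<^sup>2 * s)) integrable_on {0..L}"
          by (intro integrable_continuous_interval continuous_intros continuous_on_slice_x[OF cB(1) s\<delta>])
        show "G t (x, s) \<le> B t (x, s) + 2 * C\<^sup>2 * (E t 0 * M\<^sup>2 * s)" if "x \<in> {0..L}" for x
          unfolding G_def split_conv by (intro add_left_mono mult_left_mono le that) auto
      qed
      also have "\<dots> = R s"
        unfolding R_def using L
        by (subst integral_add)
          (auto intro!: integrable_continuous_interval continuous_intros continuous_on_slice_x[OF cB(1) s\<delta>])
      finally show ?thesis .
    qed
    finally show False using r(2)[OF s\<delta>] s R0 by (simp add: dist_real_def)
  qed
  have \<Phi>_ge: "- (6 * M\<^sup>2 * t * E t \<delta> * L) \<le> \<Phi> t \<delta>" if t: "0 \<le> t" for t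
  proof -
    have "integral {0..L} (\<lambda>x. - (6 * M\<^sup>2 * t * E t \<delta>)) \<le> \<Phi> t \<delta>"
      unfolding \<Phi>_def
    proof (rule integral_le)
      show "(\<lambda>x. G t (x, \<delta>)) integrable_on {0..L}"
        by (intro integrable_continuous_interval continuous_on_slice_x[OF cG(1)[OF \<delta>(1)]]) auto
      show "- (6 * M\<^sup>2 * t * E t \<delta>) \<le> G t (x, \<delta>)" if x: "x \<in> {0..L}" for x
      proof -
        let ?v = "v (x, \<delta>)" and ?vx = "vx (x, \<delta>)" and ?vy = "vy (x, \<delta>)" and ?w = "g t (x, \<delta>)"
        let ?p = "t * (2 - \<delta>)"
        have p: "0 \<le> ?p" "?p \<le> 2 * t" using t \<delta> by (auto intro!: mult_left_mono simp: mult.commute)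
        have m: "\<bar>?v\<bar> \<le> M" "\<bar>?vx\<bar> \<le> M" "\<bar>?vy\<bar> \<le> M" using M(2)[OF x, of \<delta>] \<delta> by auto
        have "?vx\<^sup>2 \<le> M\<^sup>2" using m(2) M(1) by (intro abs_le_square_iff[THEN iffD1]) auto
        then have 1: "?p * ?vx\<^sup>2 \<le> 2 * t * M\<^sup>2" by (rule mult_mono[OF p(2)]) (use t in auto)
        have "\<bar>?v * ?vy\<bar> \<le> M * M" unfolding abs_mult using m M(1) by (intro mult_mono) auto
        then have 2: "t * (?v * ?vy) \<le> t * M\<^sup>2" using t by (intro mult_left_mono) (auto simp: power2_eq_square)
        have 3: "0 \<le> ?p * ?w\<^sup>2" "0 \<le> ?p ^ 3 * ?v\<^sup>2" "0 \<le> t * (?p * ?v\<^sup>2)"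
          by (intro mult_nonneg_nonneg p(1) t zero_le_power zero_le_power2)+
        have "- 2 * (t * (\<delta> - 2)) * ?w\<^sup>2 + 2 * (t * (\<delta> - 2)) * ?vx\<^sup>2 - 2 * (t * (\<delta> - 2)) ^ 3 * ?v\<^sup>2 - 2 * t * ?v * ?w
          = 2 * (?p * ?w\<^sup>2) - 2 * (?p * ?vx\<^sup>2) + 2 * (?p ^ 3 * ?v\<^sup>2) - 2 * (t * (?v * ?vy)) + 2 * (t * (?p * ?v\<^sup>2))"
          (is "?lhs = _")
        proof -
          have q: "t * (\<delta> - 2) = - ?p" by (simp add: algebra_simps)
          have w: "?w = ?vy - ?p * ?v" by (simp add: g_def algebra_simps)
          have "t * ?v * ?w = t * (?v * ?vy) - t * (?p * ?v\<^sup>2)"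
            unfolding w by (simp add: algebra_simps power2_eq_square)
          then show ?thesis unfolding q by simp
        qed
        then have "?lhs \<ge> - (6 * t * M\<^sup>2)" using 1 2 3 by linarith
        then have "E t \<delta> * - (6 * t * M\<^sup>2) \<le> E t \<delta> * ?lhs" by (intro mult_left_mono) (auto simp: E_def)
        moreover have "0 \<le> 2 * C\<^sup>2 * (E t \<delta> * ?v\<^sup>2 / \<delta>)" using \<delta> by (simp add: E_def)
        ultimately show ?thesis by (simp add: G_def B_def mult.commute mult.left_commute)
      qed
    qed auto
    then show ?thesis using L by (simp add: mult_ac)
  qed
  have Hz: "H y = 0" if y: "y \<in> {0<..<\<delta>}" for y
  proof (rule ccontr)
    assume "H y \<noteq> 0"
    then have Hy: "H y > 0" using H0[of y] y by auto
    have cH: "continuous_on {0..\<delta>} H"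
    proof -
      have "partial_y {0..\<delta>} (\<lambda>z. (v z)\<^sup>2) (\<lambda>z. 2 * v z * vy z)"
        unfolding partial_y_def
        by (intro allI ballI, rule DERIV_cong[OF DERIV_power[OF partial_yD[OF py(1) _ order_refl]]]) auto
      note fl = flux_derivative[of L 0 \<delta> "\<lambda>_. 0" "\<lambda>_. 0", OF _ _ this]
      have "((\<lambda>y. integral {0..L} (\<lambda>x. (v (x, y))\<^sup>2)) has_real_derivative
          integral {0..L} (\<lambda>x. 0 + 2 * v (x, y) * vy (x, y))) (at y within {0..\<delta>})" if "y \<in> {0..\<delta>}" for y
        by (rule fl) (use L that in \<open>auto simp: partial_x_def intro!: continuous_intros c\<close>)
      then show ?thesis unfolding H_def by (rule DERIV_continuous_on)
    qed
    have "y \<in> {0..\<delta>}" "0 < H y / 2" using Hy y by auto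
    from cH[unfolded continuous_on_iff, rule_format, OF this] obtain r where r: "r > 0" "\<And>s. s \<in> {0..\<delta>} \<Longrightarrow> dist s y < r \<Longrightarrow> dist (H s) (H y) < H y / 2"
      by blast
    define a where "a = max (y / 2) (y - r / 2)"
    have a: "0 < a" "a < y" "y - r < a" using y r(1) by (auto simp: a_def)
    have \<eta>: "H y / 2 \<le> H s" if "s \<in> {a..y}" for s
    proof -
      have "\<bar>H s - H y\<bar> < H y / 2"
        using r(2)[of s] that a y by (auto simp: dist_real_def)
      then show ?thesis by linarith
    qed
    have bdd: "4 * t\<^sup>2 * ((y - a) * (H y / 2)) \<le> 6 * M\<^sup>2 * L" if t: "C\<^sup>2 \<le> t" "0 < t" for t
    proof -
      have "- (6 * M\<^sup>2 * t * E t \<delta> * L) \<le> \<Phi> t \<delta>" using \<Phi>_ge t by simp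
      also have "\<dots> \<le> \<Phi> t y" using decr[of y \<delta> t 0] t y H0 by auto
      also have "\<dots> \<le> \<Phi> t a + (y - a) * - (4 * t ^ 3 * E t y * (H y / 2))"
        using decr[of a y t "H y / 2"] a y t \<eta> Hy by auto
      also have "\<dots> \<le> (y - a) * - (4 * t ^ 3 * E t y * (H y / 2))"
        using \<Phi>_le[of a t] a y t by auto
      finally have "(E t y * t) * (4 * t\<^sup>2 * ((y - a) * (H y / 2))) \<le> (E t \<delta> * t) * (6 * M\<^sup>2 * L)"
        by (simp add: algebra_simps power2_eq_square power3_eq_cube)
      also have "\<dots> \<le> (E t y * t) * (6 * M\<^sup>2 * L)"
      proof -
        have "(\<delta> - 2)\<^sup>2 \<le> (y - 2)\<^sup>2"
          using y \<delta> by (intro abs_le_square_iff[THEN iffD1]) auto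
        then have "E t \<delta> \<le> E t y" unfolding E_def using t by (simp add: mult_left_mono)
        then show ?thesis using t L by (intro mult_right_mono) auto
      qed
      finally show ?thesis using t by (simp add: E_def)
    qed
    define k where "k = (y - a) * (H y / 2)"
    have "k > 0" using a Hy by (simp add: k_def)
    define t where "t = max (max (C\<^sup>2) 1) (6 * M\<^sup>2 * L / k)"
    have t: "C\<^sup>2 \<le> t" "1 \<le> t" "6 * M\<^sup>2 * L / k \<le> t"
      by (auto simp: t_def)
    have "6 * M\<^sup>2 * L \<le> k * t"
      using t(3) \<open>k > 0\<close> by (simp add: pos_divide_le_eq mult.commute)
    also have "\<dots> < 4 * t\<^sup>2 * k"
      using mult_strict_left_mono[of 1 "4 * t" "k * t"] t(2) \<open>k > 0\<close>
      by (simp add: power2_eq_square mult_ac)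
    finally have "6 * M\<^sup>2 * L < 4 * t\<^sup>2 * k" .
    then show False using bdd[of t] t by (simp add: k_def)
  qed
  show ?thesis
  proof (cases "y = 0")
    case False
    then have y: "y \<in> {0<..<\<delta>}" "y \<in> {0..\<delta>}" using xy by auto
    have "\<forall>x\<in>{0..L}. (v (x, y))\<^sup>2 = 0"
      using Hz[OF y(1)] L unfolding H_def
      by (subst (asm) integral_eq_0_iff) (auto intro!: continuous_intros continuous_on_slice_x[OF c(1) y(2)])
    then show ?thesis using xy by simp
  qed (simp add: zero)
qed

subsection \<open>The energy identity\<close>

lemma integral_divergence_eq_0:
  assumes "0 \<le> L" "a \<le> b" "partial_x {a..b} X Xx" "partial_y {a..b} Y Yy"
    and cY: "continuous_on (UNIV \<times> {a..b}) Y" and cXx: "continuous_on (UNIV \<times> {a..b}) Xx"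
    and cYy: "continuous_on (UNIV \<times> {a..b}) Yy"
    and per: "\<And>y. y \<in> {a..b} \<Longrightarrow> X (L, y) = X (0, y)"
    and bdry: "\<And>x. Y (x, a) = 0" "\<And>x. Y (x, b) = 0"
  shows "integral (cbox (0, a) (L, b)) (\<lambda>z. Xx z + Yy z) = 0"
proof -
  have c: "continuous_on (cbox (0, a) (L, b)) (\<lambda>z. Xx z + Yy z)"
    by (rule continuous_on_subset[of "UNIV \<times> {a..b}"]) (auto intro!: continuous_intros cXx cYy simp: cbox_Pair_eq)
  have "((\<lambda>y. integral {0..L} (\<lambda>x. Xx (x, y) + Yy (x, y))) has_integral
      (integral {0..L} (\<lambda>x. Y (x, b)) - integral {0..L} (\<lambda>x. Y (x, a)))) {a..b}"
    by (rule integral_derivative_eq[OF assms(2)]) (rule flux_derivative[OF assms(1,3,4) cY cYy per])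
  then have "integral {a..b} (\<lambda>y. integral {0..L} (\<lambda>x. Xx (x, y) + Yy (x, y))) = 0"
    using bdry by (simp add: integral_unique)
  moreover have "integral (cbox (0, a) (L, b)) (\<lambda>z. Xx z + Yy z)
      = integral (cbox a b) (\<lambda>y. integral (cbox 0 L) (\<lambda>x. Xx (x, y) + Yy (x, y)))"
    using integral_swap_continuous[of 0 a L b "\<lambda>x y. Xx (x, y) + Yy (x, y)"] c integral_prod_continuous[OF c]
    by (simp add: split_beta)
  ultimately show ?thesis by simp
qed

text \<open>For \<open>\<epsilon> \<rightarrow> 0\<close>, a continuously differentiable substitute for \<open>1/s\<close> on \<open>s < 0\<close>.\<close>

definition neg_recip :: "real \<Rightarrow> real \<Rightarrow> real" where
  "neg_recip \<epsilon> s = (min s 0) ^ 3 / (s ^ 4 + \<epsilon>)"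

definition neg_recip' :: "real \<Rightarrow> real \<Rightarrow> real" where
  "neg_recip' \<epsilon> s = 3 * (min s 0)\<^sup>2 / (s ^ 4 + \<epsilon>) - 4 * s ^ 3 * (min s 0) ^ 3 / (s ^ 4 + \<epsilon>)\<^sup>2"

lemma DERIV_min_cube:
  "((\<lambda>s. (min s 0) ^ 3) has_real_derivative 3 * (min s 0)\<^sup>2) (at (s::real))"
proof (cases s "0::real" rule: linorder_cases)
  case less
  have "((\<lambda>s. s ^ 3) has_real_derivative 3 * (min s 0)\<^sup>2) (at s)"
    using less by (auto intro!: derivative_eq_intros)
  then show ?thesis
    by (rule has_field_derivative_transform_within_open[of _ _ _ "{..<0}"]) (use less in auto)
next
  case greater
  have "((\<lambda>s. 0) has_real_derivative 3 * (min s 0)\<^sup>2) (at s)"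
    using greater by simp
  then show ?thesis
    by (rule has_field_derivative_transform_within_open[of _ _ _ "{0<..}"]) (use greater in auto)
next
  case equal
  have "((\<lambda>h::real. (min h 0)\<^sup>2) \<longlongrightarrow> (min 0 0)\<^sup>2) (at 0)"
    by (intro tendsto_intros)
  then have "(\<lambda>h::real. ((min (0 + h) 0) ^ 3 - (min 0 0) ^ 3) / h) \<midarrow>0\<rightarrow> 0"
    by (rule Lim_transform_within[where d = 1, THEN tendsto_eq_rhs]) (auto simp: min_def power2_eq_square power3_eq_cube)
  then show ?thesis using equal by (simp add: DERIV_def)
qed

lemma DERIV_neg_recip:
  assumes "\<epsilon> > 0"
  shows "(neg_recip \<epsilon> has_real_derivative neg_recip' \<epsilon> s) (at s)"
proof -
  have pos: "s ^ 4 + \<epsilon> > 0" using assms by (simp add: add_nonneg_pos)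
  have den: "((\<lambda>s. s ^ 4 + \<epsilon>) has_real_derivative 4 * s ^ 3) (at s)"
    by (auto intro!: derivative_eq_intros)
  show ?thesis
    unfolding neg_recip_def[abs_def] neg_recip'_def
    by (rule DERIV_cong[OF DERIV_divide[OF DERIV_min_cube den]])
      (use pos in \<open>auto simp: diff_divide_distrib power2_eq_square\<close>)
qed

lemma neg_recip_bounds:
  assumes "\<epsilon> > 0"
  shows "\<bar>s * neg_recip \<epsilon> s\<bar> \<le> 1" "\<bar>s\<^sup>2 * neg_recip' \<epsilon> s\<bar> \<le> 1"
proof -
  define r where "r = s ^ 4 / (s ^ 4 + \<epsilon>)"
  have pos: "s ^ 4 + \<epsilon> > 0" using assms by (simp add: add_nonneg_pos)
  have r: "0 \<le> r" "r \<le> 1" using pos assms by (auto simp: r_def)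
  show "\<bar>s * neg_recip \<epsilon> s\<bar> \<le> 1"
  proof (cases "s < 0")
    case True
    then have "s * neg_recip \<epsilon> s = r" by (simp add: neg_recip_def r_def power3_eq_cube power4_eq_xxxx)
    then show ?thesis using r by simp
  qed (simp add: neg_recip_def)
  show "\<bar>s\<^sup>2 * neg_recip' \<epsilon> s\<bar> \<le> 1"
  proof (cases "s < 0")
    case True
    have eqs: "s\<^sup>2 * (3 * s\<^sup>2) = 3 * s ^ 4" "s\<^sup>2 * (4 * s ^ 3 * s ^ 3) = 4 * (s ^ 4)\<^sup>2"
      by (simp_all add: eval_nat_numeral)
    have "s\<^sup>2 * neg_recip' \<epsilon> s
        = s\<^sup>2 * (3 * s\<^sup>2) / (s ^ 4 + \<epsilon>) - s\<^sup>2 * (4 * s ^ 3 * s ^ 3) / (s ^ 4 + \<epsilon>)\<^sup>2"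
      using True by (simp add: neg_recip'_def right_diff_distrib)
    also have "\<dots> = 3 * r - 4 * r\<^sup>2"
      unfolding eqs r_def power_divide by simp
    finally have "s\<^sup>2 * neg_recip' \<epsilon> s = 3 * r - 4 * r\<^sup>2" .
    then have "s\<^sup>2 * neg_recip' \<epsilon> s = r * (3 - 4 * r)" by (simp add: algebra_simps power2_eq_square)
    moreover have "\<bar>r * (3 - 4 * r)\<bar> \<le> 1"
    proof -
      have "0 \<le> (1 - r) * (1 + 4 * r)" using r by simp
      moreover have "0 \<le> (1 - 2 * r)\<^sup>2 + r" using r by simp
      ultimately show ?thesis by (intro abs_leI) (simp_all add: algebra_simps power2_eq_square)
    qed
    ultimately show ?thesis by simp
  qed (simp add: neg_recip'_def)
qed

lemma neg_recip_tendsto: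
  assumes "s < 0" "\<epsilon> \<longlonglongrightarrow> 0"
  shows "(\<lambda>n. neg_recip (\<epsilon> n) s) \<longlonglongrightarrow> 1 / s" "(\<lambda>n. neg_recip' (\<epsilon> n) s) \<longlonglongrightarrow> - 1 / s\<^sup>2"
proof -
  have "(\<lambda>n. neg_recip (\<epsilon> n) s) \<longlonglongrightarrow> (min s 0) ^ 3 / (s ^ 4 + 0)"
    unfolding neg_recip_def by (intro tendsto_intros assms) (use assms in auto)
  then show "(\<lambda>n. neg_recip (\<epsilon> n) s) \<longlonglongrightarrow> 1 / s"
    by (rule tendsto_eq_rhs) (use assms in \<open>simp add: min_def power3_eq_cube power4_eq_xxxx\<close>)
  have "(\<lambda>n. neg_recip' (\<epsilon> n) s) \<longlonglongrightarrow>
      3 * (min s 0)\<^sup>2 / (s ^ 4 + 0) - 4 * s ^ 3 * (min s 0) ^ 3 / (s ^ 4 + 0)\<^sup>2"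
    unfolding neg_recip'_def by (intro tendsto_intros assms) (use assms in auto)
  then show "(\<lambda>n. neg_recip' (\<epsilon> n) s) \<longlonglongrightarrow> - 1 / s\<^sup>2"
    by (rule tendsto_eq_rhs)
      (use assms in \<open>simp add: min_def field_simps power2_eq_square power3_eq_cube power4_eq_xxxx\<close>)
qed

locale periodic_C2 =
  fixes L d :: real and f fx fy fxx fxy fyy :: "real \<times> real \<Rightarrow> real"
  assumes L: "L > 0" and d: "d > 0"
    and partials: "partial_x {-d..d} f fx" "partial_y {-d..d} f fy" "partial_x {-d..d} fx fxx"
      "partial_y {-d..d} fx fxy" "partial_x {-d..d} fy fxy" "partial_y {-d..d} fy fyy"
    and cont: "continuous_on (UNIV \<times> {-d..d}) f" "continuous_on (UNIV \<times> {-d..d}) fx"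
      "continuous_on (UNIV \<times> {-d..d}) fy" "continuous_on (UNIV \<times> {-d..d}) fxx"
      "continuous_on (UNIV \<times> {-d..d}) fxy" "continuous_on (UNIV \<times> {-d..d}) fyy"
    and periodic: "\<And>x y. y \<in> {-d..d} \<Longrightarrow> f (x + L, y) = f (x, y)"
      "\<And>x y. y \<in> {-d..d} \<Longrightarrow> fx (x + L, y) = fx (x, y)" "\<And>x y. y \<in> {-d..d} \<Longrightarrow> fy (x + L, y) = fy (x, y)"
begin

lemma periodic_int:
  assumes "y \<in> {-d..d}"
  shows "f (x + of_int n * L, y) = f (x, y)" "fx (x + of_int n * L, y) = fx (x, y)"
proof -
  have *: "h (x + of_int n * L) = h x" if "\<And>x. h (x + L) = h x" for h :: "real \<Rightarrow> real" and x n
  proof (induction n rule: int_induct[where k = 0])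
    case (step1 i)
    have "h (x + of_int (i + 1) * L) = h ((x + of_int i * L) + L)" by (simp add: algebra_simps)
    also have "\<dots> = h x" using step1 by (simp only: that)
    finally show ?case .
  next
    case (step2 i)
    have "h (x + of_int (i - 1) * L) = h ((x + of_int (i - 1) * L) + L)" by (simp only: that)
    also have "\<dots> = h (x + of_int i * L)" by (simp add: algebra_simps)
    finally show ?case using step2 by simp
  qed simp
  show "f (x + of_int n * L, y) = f (x, y)" "fx (x + of_int n * L, y) = fx (x, y)"
    using *[of "\<lambda>x. f (x, y)"] *[of "\<lambda>x. fx (x, y)"] periodic assms by auto
qed

end

lemma period_representative:
  fixes L x :: real
  assumes "L > 0"
  obtains n :: int where "x + of_int n * L \<in> {a..<a + L}"
proof
  have "of_int \<lfloor>(x - a) / L\<rfloor> * L \<le> x - a" "x - a < (of_int \<lfloor>(x - a) / L\<rfloor> + 1) * L"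
    using assms by (simp_all add: pos_le_divide_eq[symmetric] pos_divide_less_eq[symmetric])
  then show "x + of_int (- \<lfloor>(x - a) / L\<rfloor>) * L \<in> {a..<a + L}"
    by (simp add: algebra_simps)
qed

locale rayleigh =
  U: periodic_C2 L d U Ux Uy Uxx Uxy Uyy + v: periodic_C2 L d v vx vy vxx vxy vyy
  for L d U Ux Uy Uxx Uxy Uyy v vx vy vxx vxy vyy +
  fixes \<beta> :: real
  assumes \<beta>: "\<beta> \<ge> 0"
    and rayleigh_eq: "\<And>x y. y \<in> {-d..d} \<Longrightarrow>
      U (x, y) * (vxx (x, y) + vyy (x, y)) = v (x, y) * (Uxx (x, y) + Uyy (x, y) - \<beta>)"
    and wall: "\<And>x. v (x, d) = 0" "\<And>x. v (x, -d) = 0"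
    and noncritical: "\<And>x y. y \<in> {-d..d} \<Longrightarrow> U (x, y) = 0 \<Longrightarrow> \<beta> - (Uxx (x, y) + Uyy (x, y)) \<noteq> 0"
begin

lemma rayleigh_quotient_bounded:
  obtains K where "\<And>x y. x \<in> {0..2 * L} \<Longrightarrow> y \<in> {-d..d} \<Longrightarrow> \<bar>v (x, y)\<bar> \<le> K * \<bar>U (x, y)\<bar>" "0 \<le> K"
proof -
  let ?R = "{0..2 * L} \<times> {-d..d}"
  have cpt: "compact ?R" by (intro compact_Times compact_Icc)
  have ne: "?R \<noteq> {}" using U.L U.d by auto
  have sub: "?R \<subseteq> UNIV \<times> {-d..d}" by auto
  define q where "q z = \<beta> - (Uxx z + Uyy z)" for z
  note [continuous_intros] = U.cont[THEN continuous_on_subset, OF sub] v.cont[THEN continuous_on_subset, OF sub]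
  have "continuous_on ?R (\<lambda>z. \<bar>U z\<bar> + \<bar>q z\<bar>)" unfolding q_def by (intro continuous_intros)
  from continuous_attains_inf[OF cpt ne this] obtain z0 where z0: "z0 \<in> ?R"
    "\<And>z. z \<in> ?R \<Longrightarrow> \<bar>U z0\<bar> + \<bar>q z0\<bar> \<le> \<bar>U z\<bar> + \<bar>q z\<bar>" by blast
  have "continuous_on ?R (\<lambda>z. \<bar>v z\<bar> + \<bar>vxx z + vyy z\<bar>)" by (intro continuous_intros)
  from continuous_attains_sup[OF cpt ne this] obtain z1 where z1:
    "\<And>z. z \<in> ?R \<Longrightarrow> \<bar>v z\<bar> + \<bar>vxx z + vyy z\<bar> \<le> \<bar>v z1\<bar> + \<bar>vxx z1 + vyy z1\<bar>" by blast
  define m where "m = \<bar>U z0\<bar> + \<bar>q z0\<bar>"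
  define M where "M = \<bar>v z1\<bar> + \<bar>vxx z1 + vyy z1\<bar>"
  have "m > 0" using noncritical[of "snd z0" "fst z0"] z0(1)
    by (cases "U z0 = 0") (auto simp: m_def q_def mem_Times_iff)
  have "M \<ge> 0" by (simp add: M_def)
  show ?thesis
  proof (rule that[of "M / m"])
    fix x y assume xy: "x \<in> {0..2 * L}" "y \<in> {-d..d}"
    let ?z = "(x, y)"
    have "\<bar>v ?z\<bar> * m \<le> \<bar>v ?z\<bar> * (\<bar>U ?z\<bar> + \<bar>q ?z\<bar>)"
      using z0(2)[of ?z] xy by (intro mult_left_mono) (auto simp: m_def)
    also have "\<dots> = \<bar>U ?z\<bar> * (\<bar>v ?z\<bar> + \<bar>vxx ?z + vyy ?z\<bar>)"
    proof -
      have "\<bar>v ?z\<bar> * \<bar>q ?z\<bar> = \<bar>U ?z\<bar> * \<bar>vxx ?z + vyy ?z\<bar>"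
        unfolding abs_mult[symmetric] rayleigh_eq[OF xy(2)]
        by (metis abs_minus_cancel minus_diff_eq mult_minus_right q_def)
      then show ?thesis by (simp add: algebra_simps)
    qed
    also have "\<dots> \<le> \<bar>U ?z\<bar> * M"
      using z1[of ?z] xy by (intro mult_left_mono) (auto simp: M_def)
    finally show "\<bar>v ?z\<bar> \<le> M / m * \<bar>U ?z\<bar>" using \<open>m > 0\<close> by (simp add: field_simps)
  qed (use \<open>m > 0\<close> \<open>M \<ge> 0\<close> in simp)
qed

lemma rayleigh_energy:
  assumes x: "0 < x" "x < 2 * L" and y: "- d < y" "y < d" and neg: "U (x, y) < 0"
  shows "U (x, y) * vx (x, y) = v (x, y) * Ux (x, y)" "U (x, y) * vy (x, y) = v (x, y) * Uy (x, y)"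
    "\<beta> * (v (x, y))\<^sup>2 = 0"
proof -
  obtain K where K: "\<And>x y. x \<in> {0..2 * L} \<Longrightarrow> y \<in> {-d..d} \<Longrightarrow> \<bar>v (x, y)\<bar> \<le> K * \<bar>U (x, y)\<bar>" "0 \<le> K"
    by (rule rayleigh_quotient_bounded) blast
  let ?R = "cbox (0, - d) (2 * L, d)"
  have R: "?R = {0..2 * L} \<times> {-d..d}" by (simp add: cbox_Pair_eq)
  have sub: "?R \<subseteq> UNIV \<times> {-d..d}" by (auto simp: R)
  define \<epsilon> where "\<epsilon> n = inverse (real (Suc n))" for n
  have \<epsilon>: "\<epsilon> n > 0" for n by (simp add: \<epsilon>_def)
  have \<epsilon>0: "\<epsilon> \<longlonglongrightarrow> 0" unfolding \<epsilon>_def by (rule LIMSEQ_inverse_real_of_nat)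
  define G where "G n z = neg_recip (\<epsilon> n) (U z)" for n z
  define G' where "G' n z = neg_recip' (\<epsilon> n) (U z)" for n z
  define X where "X n z = v z * G n z * (U z * vx z - v z * Ux z)" for n z
  define Y where "Y n z = v z * G n z * (U z * vy z - v z * Uy z)" for n z
  define X' where "X' n z = (vx z * G n z + v z * (G' n z * Ux z)) * (U z * vx z - v z * Ux z)
    + v z * G n z * (U z * vxx z - v z * Uxx z)" for n z
  define Y' where "Y' n z = (vy z * G n z + v z * (G' n z * Uy z)) * (U z * vy z - v z * Uy z)
    + v z * G n z * (U z * vyy z - v z * Uyy z)" for n z
  have pos: "s ^ 4 + \<epsilon> n \<noteq> 0" for s n
    using add_nonneg_pos[OF _ \<epsilon>[of n], of "s ^ 4"] by simp
  have cG: "continuous_on (UNIV \<times> {-d..d}) (G n)" "continuous_on (UNIV \<times> {-d..d}) (G' n)" for n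
    unfolding G_def G'_def neg_recip_def neg_recip'_def
    by (intro continuous_intros U.cont; use pos in simp)+
  note ci = continuous_intros cG U.cont v.cont
  have cX: "continuous_on (UNIV \<times> {-d..d}) (X' n)" "continuous_on (UNIV \<times> {-d..d}) (Y n)"
    "continuous_on (UNIV \<times> {-d..d}) (Y' n)" for n
    unfolding X'_def Y_def Y'_def by (intro ci)+
  have pX: "partial_x {-d..d} (X n) (X' n)" for n
    unfolding partial_x_def
  proof (intro allI ballI)
    fix x y assume y: "y \<in> {-d..d}"
    have g: "((\<lambda>s. G n (s, y)) has_real_derivative G' n (x, y) * Ux (x, y)) (at x)"
      unfolding G_def G'_def
      by (rule DERIV_chain2[OF DERIV_neg_recip[OF \<epsilon>] partial_xD[OF U.partials(1) y]])
    show "((\<lambda>s. X n (s, y)) has_real_derivative X' n (x, y)) (at x)"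
      unfolding X_def X'_def
      by (rule derivative_eq_intros g partial_xD[OF U.partials(1) y] partial_xD[OF U.partials(3) y]
          partial_xD[OF v.partials(1) y] partial_xD[OF v.partials(3) y] refl)+
        (simp add: algebra_simps)
  qed
  have pY: "partial_y {-d..d} (Y n) (Y' n)" for n
    unfolding partial_y_def
  proof (intro allI ballI)
    fix x y assume y: "y \<in> {-d..d}"
    have g: "((\<lambda>s. G n (x, s)) has_real_derivative G' n (x, y) * Uy (x, y)) (at y within {-d..d})"
      unfolding G_def G'_def
      by (rule DERIV_chain2[OF DERIV_neg_recip[OF \<epsilon>] partial_yD[OF U.partials(2) y order_refl]])
    show "((\<lambda>s. Y n (x, s)) has_real_derivative Y' n (x, y)) (at y within {-d..d})"
      unfolding Y_def Y'_def
      by (rule derivative_eq_intros g partial_yD[OF U.partials(2) y order_refl] partial_yD[OF U.partials(6) y order_refl]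
          partial_yD[OF v.partials(2) y order_refl] partial_yD[OF v.partials(6) y order_refl] refl)+
        (simp add: algebra_simps)
  qed
  have int0: "integral ?R (\<lambda>z. X' n z + Y' n z) = 0" for n
  proof (rule integral_divergence_eq_0[OF _ _ pX pY cX(2,1,3)])
    fix y assume y: "y \<in> {-d..d}"
    show "X n (2 * L, y) = X n (0, y)"
      using U.periodic_int[OF y, of 0 2] v.periodic_int[OF y, of 0 2]
      by (simp add: X_def G_def)
  qed (use U.L U.d wall in \<open>auto simp: Y_def\<close>)
  define Q where "Q z = (if U z < 0 then (vx z - v z / U z * Ux z)\<^sup>2 + (vy z - v z / U z * Uy z)\<^sup>2
    - \<beta> * (v z)\<^sup>2 / U z else 0)" for z
  have XY: "X' n z + Y' n z = U z * G n z * ((vx z)\<^sup>2 + (vy z)\<^sup>2)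
      + (U z * G' n z - G n z) * v z * (Ux z * vx z + Uy z * vy z)
      - G' n z * (v z)\<^sup>2 * ((Ux z)\<^sup>2 + (Uy z)\<^sup>2) - \<beta> * (v z)\<^sup>2 * G n z" if "z \<in> ?R" for n z
  proof -
    have "U z * (vxx z + vyy z) = v z * (Uxx z + Uyy z - \<beta>)"
      using rayleigh_eq[of "snd z" "fst z"] that by (auto simp: R mem_Times_iff)
    then have "(U z * vxx z - v z * Uxx z) + (U z * vyy z - v z * Uyy z) = - \<beta> * v z"
      by (simp add: algebra_simps)
    then have "v z * G n z * ((U z * vxx z - v z * Uxx z) + (U z * vyy z - v z * Uyy z)) = - \<beta> * (v z)\<^sup>2 * G n z"
      by (simp add: power2_eq_square)
    then show ?thesis
      unfolding X'_def Y'_def by (simp add: algebra_simps power2_eq_square)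
  qed
  define h where "h z = ((vx z)\<^sup>2 + (vy z)\<^sup>2) + 2 * K * \<bar>Ux z * vx z + Uy z * vy z\<bar>
      + K\<^sup>2 * ((Ux z)\<^sup>2 + (Uy z)\<^sup>2) + \<beta> * K * \<bar>v z\<bar>" for z
  have bound: "norm (X' n z + Y' n z) \<le> h z" if z: "z \<in> ?R" for n z
  proof -
    have Kz: "\<bar>v z\<bar> \<le> K * \<bar>U z\<bar>" using K(1)[of "fst z" "snd z"] z by (auto simp: R mem_Times_iff)
    have 1: "\<bar>U z * G n z\<bar> \<le> 1" "\<bar>(U z)\<^sup>2 * G' n z\<bar> \<le> 1"
      using neg_recip_bounds[OF \<epsilon>] by (auto simp: G_def G'_def)
    have 2: "\<bar>G n z * v z\<bar> \<le> K"
    proof -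
      have "\<bar>G n z\<bar> * \<bar>v z\<bar> \<le> \<bar>G n z\<bar> * (K * \<bar>U z\<bar>)" using Kz by (rule mult_left_mono) simp
      also have "\<dots> = K * \<bar>U z * G n z\<bar>" by (simp add: abs_mult)
      also have "\<dots> \<le> K * 1" using 1 K(2) by (intro mult_left_mono) auto
      finally show ?thesis by (simp add: abs_mult)
    qed
    have 3: "\<bar>U z * G' n z * v z\<bar> \<le> K"
    proof -
      have "\<bar>U z * G' n z\<bar> * \<bar>v z\<bar> \<le> \<bar>U z * G' n z\<bar> * (K * \<bar>U z\<bar>)" using Kz by (rule mult_left_mono) simp
      also have "\<dots> = K * \<bar>(U z)\<^sup>2 * G' n z\<bar>" by (simp add: abs_mult power2_eq_square)
      also have "\<dots> \<le> K * 1" using 1 K(2) by (intro mult_left_mono) auto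
      finally show ?thesis by (simp add: abs_mult)
    qed
    have 4: "\<bar>G' n z * (v z)\<^sup>2\<bar> \<le> K\<^sup>2"
    proof -
      have "(v z)\<^sup>2 \<le> (K * \<bar>U z\<bar>)\<^sup>2" using Kz K(2) by (intro abs_le_square_iff[THEN iffD1]) auto
      then have "\<bar>G' n z\<bar> * (v z)\<^sup>2 \<le> \<bar>G' n z\<bar> * (K * \<bar>U z\<bar>)\<^sup>2" by (rule mult_left_mono) simp
      also have "\<dots> = K\<^sup>2 * \<bar>(U z)\<^sup>2 * G' n z\<bar>" by (simp add: abs_mult power_mult_distrib)
      also have "\<dots> \<le> K\<^sup>2 * 1" using 1 by (intro mult_left_mono) auto
      finally show ?thesis by (simp add: abs_mult)
    qed
    have "\<bar>U z * G n z * ((vx z)\<^sup>2 + (vy z)\<^sup>2)\<bar> \<le> 1 * ((vx z)\<^sup>2 + (vy z)\<^sup>2)"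
      unfolding abs_mult[of "U z * G n z"] using 1(1) by (intro mult_mono) auto
    moreover have "\<bar>(U z * G' n z - G n z) * v z * (Ux z * vx z + Uy z * vy z)\<bar> \<le> 2 * K * \<bar>Ux z * vx z + Uy z * vy z\<bar>"
    proof -
      have "\<bar>(U z * G' n z - G n z) * v z\<bar> \<le> 2 * K" using 2 3 by (simp add: left_diff_distrib)
      then show ?thesis unfolding abs_mult[of "(U z * G' n z - G n z) * v z"] by (rule mult_right_mono) simp
    qed
    moreover have "\<bar>G' n z * (v z)\<^sup>2 * ((Ux z)\<^sup>2 + (Uy z)\<^sup>2)\<bar> \<le> K\<^sup>2 * ((Ux z)\<^sup>2 + (Uy z)\<^sup>2)"
      unfolding abs_mult[of "G' n z * (v z)\<^sup>2"] using 4 by (intro mult_mono) auto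
    moreover have "\<bar>\<beta> * (v z)\<^sup>2 * G n z\<bar> \<le> \<beta> * K * \<bar>v z\<bar>"
    proof -
      have "\<bar>\<beta> * (v z)\<^sup>2 * G n z\<bar> = \<beta> * \<bar>v z\<bar> * \<bar>G n z * v z\<bar>"
        using \<beta> by (simp add: abs_mult power2_eq_square)
      also have "\<dots> \<le> \<beta> * \<bar>v z\<bar> * K" using 2 \<beta> by (intro mult_left_mono) auto
      finally show ?thesis by (simp add: mult_ac)
    qed
    moreover have "\<bar>a\<bar> \<le> 1 * A \<Longrightarrow> \<bar>b\<bar> \<le> B \<Longrightarrow> \<bar>c\<bar> \<le> C \<Longrightarrow> \<bar>e\<bar> \<le> D \<Longrightarrow> \<bar>a + b - c - e\<bar> \<le> A + B + C + D"
      for a b c e A B C D :: real by linarith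
    ultimately show ?thesis unfolding XY[OF z] h_def real_norm_def by blast
  qed
  have lim: "(\<lambda>n. X' n z + Y' n z) \<longlonglongrightarrow> Q z" if z: "z \<in> ?R" for z
  proof (cases "U z < 0")
    case True
    note nt = neg_recip_tendsto[OF True \<epsilon>0]
    have "(\<lambda>n. X' n z + Y' n z) \<longlonglongrightarrow> U z * (1 / U z) * ((vx z)\<^sup>2 + (vy z)\<^sup>2)
      + (U z * (- 1 / (U z)\<^sup>2) - 1 / U z) * v z * (Ux z * vx z + Uy z * vy z)
      - (- 1 / (U z)\<^sup>2) * (v z)\<^sup>2 * ((Ux z)\<^sup>2 + (Uy z)\<^sup>2) - \<beta> * (v z)\<^sup>2 * (1 / U z)"
      unfolding XY[OF z] G_def G'_def by (intro tendsto_intros nt)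
    moreover have "Q z = U z * (1 / U z) * ((vx z)\<^sup>2 + (vy z)\<^sup>2)
      + (U z * (- 1 / (U z)\<^sup>2) - 1 / U z) * v z * (Ux z * vx z + Uy z * vy z)
      - (- 1 / (U z)\<^sup>2) * (v z)\<^sup>2 * ((Ux z)\<^sup>2 + (Uy z)\<^sup>2) - \<beta> * (v z)\<^sup>2 * (1 / U z)"
      using True unfolding Q_def by (simp add: field_simps power2_eq_square)
    ultimately show ?thesis by simp
  next
    case False
    then have "G n z = 0" "G' n z = 0" for n by (auto simp: G_def G'_def neg_recip_def neg_recip'_def)
    then show ?thesis using False by (simp add: XY[OF z] Q_def)
  qed
  have intXY: "(\<lambda>z. X' n z + Y' n z) integrable_on ?R" for n
    by (intro integrable_continuous continuous_on_add cX[THEN continuous_on_subset, OF sub])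
  have inth: "h integrable_on ?R"
    unfolding h_def
    by (intro integrable_continuous continuous_intros U.cont[THEN continuous_on_subset, OF sub]
        v.cont[THEN continuous_on_subset, OF sub])
  note dc = dominated_convergence[OF intXY inth bound lim]
  have Qint: "Q integrable_on ?R" by (rule dc(1))
  have "integral ?R Q = 0" using dc(2) by (simp add: int0 LIMSEQ_const_iff)
  have nonpos: "\<beta> * (v z)\<^sup>2 / U z \<le> 0" if "U z < 0" for z
    using \<beta> that by (intro divide_nonneg_neg) auto
  have Qpos: "Q z \<ge> 0" for z
  proof (cases "U z < 0")
    case True
    then show ?thesis
      using nonpos[OF True] sum_power2_ge_zero[of "vx z - v z / U z * Ux z" "vy z - v z / U z * Uy z"]
      unfolding Q_def by (simp only: if_True; linarith)
  qed (simp add: Q_def)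
  have box_Pair_eq: "box (0, - d) (2 * L, d) = {0<..<2 * L} \<times> {- d<..<d}"
    by (auto simp: box_def Basis_prod_def)
  let ?S = "{z \<in> box (0, - d) (2 * L, d). U z < 0}"
  have "open (box (0, - d) (2 * L, d) \<inter> U -` {..<0})"
    by (rule continuous_open_preimage[OF continuous_on_subset[OF U.cont(1)]]) (auto simp: box_Pair_eq intro: open_Times)
  then have "open ?S" by (simp add: vimage_def Int_def)
  moreover have "(x, y) \<in> ?S" using x y neg by (simp add: box_Pair_eq)
  ultimately obtain a b where ab: "cbox a b \<subseteq> ?S" "(x, y) \<in> box a b"
    by (rule open_contains_cbox)
  have cU: "continuous_on (cbox a b) f" if "continuous_on (UNIV \<times> {-d..d}) f" for f :: "real \<times> real \<Rightarrow> real"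
    by (rule continuous_on_subset[OF that]) (use ab(1) in \<open>auto simp: box_Pair_eq\<close>)
  have cQ: "continuous_on (cbox a b) Q"
  proof -
    have "continuous_on (cbox a b) (\<lambda>z. (vx z - v z / U z * Ux z)\<^sup>2 + (vy z - v z / U z * Uy z)\<^sup>2 - \<beta> * (v z)\<^sup>2 / U z)"
      by (intro continuous_intros cU U.cont v.cont) (use ab(1) in auto)
    then show ?thesis
      by (rule continuous_on_eq) (use ab(1) in \<open>auto simp: Q_def\<close>)
  qed
  have "integral (cbox a b) Q \<le> integral ?R Q"
    by (rule integral_subset_le[OF _ integrable_continuous[OF cQ] Qint])
      (use ab(1) Qpos in \<open>auto simp: box_Pair_eq cbox_Pair_eq\<close>)
  moreover have "0 \<le> integral (cbox a b) Q"
    by (rule integral_nonneg[OF integrable_continuous[OF cQ]]) (rule Qpos)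
  ultimately have "(Q has_integral 0) (cbox a b)"
    using \<open>integral ?R Q = 0\<close> integrable_continuous[OF cQ] by (simp add: has_integral_integrable_integral)
  from has_integral_0_cbox_imp_0[OF cQ Qpos this] have "Q (x, y) = 0"
    using ab(2) box_subset_cbox by blast
  moreover note nonpos[OF neg]
  ultimately have "(vx (x, y) - v (x, y) / U (x, y) * Ux (x, y))\<^sup>2 = 0"
    "(vy (x, y) - v (x, y) / U (x, y) * Uy (x, y))\<^sup>2 = 0" "\<beta> * (v (x, y))\<^sup>2 / U (x, y) = 0"
    using neg zero_le_power2[of "vx (x, y) - v (x, y) / U (x, y) * Ux (x, y)"]
      zero_le_power2[of "vy (x, y) - v (x, y) / U (x, y) * Uy (x, y)"]
    unfolding Q_def by (simp_all only: if_True; linarith)+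
  then show "U (x, y) * vx (x, y) = v (x, y) * Ux (x, y)" "U (x, y) * vy (x, y) = v (x, y) * Uy (x, y)"
    "\<beta> * (v (x, y))\<^sup>2 = 0"
    using neg by (auto simp: field_simps)
qed

end

subsection \<open>Propagation of zeros\<close>

lemma bounded_below_near_line:
  fixes F :: "real \<times> real \<Rightarrow> real"
  assumes c: "continuous_on (UNIV \<times> {a..b}) F" and y1: "y1 \<in> {a..b}" and "0 \<le> L"
    and nz: "\<And>x. x \<in> {0..L} \<Longrightarrow> F (x, y1) \<noteq> 0"
  obtains m \<delta> where "m > 0" "\<delta> > 0"
    "\<And>x y. x \<in> {0..L} \<Longrightarrow> y \<in> {a..b} \<Longrightarrow> \<bar>y - y1\<bar> \<le> \<delta> \<Longrightarrow> m \<le> \<bar>F (x, y)\<bar>"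
proof -
  have "continuous_on {0..L} (\<lambda>x. \<bar>F (x, y1)\<bar>)"
    by (intro continuous_intros continuous_on_slice_x[OF c y1])
  then obtain x0 where x0: "x0 \<in> {0..L}" "\<And>x. x \<in> {0..L} \<Longrightarrow> \<bar>F (x0, y1)\<bar> \<le> \<bar>F (x, y1)\<bar>"
    using continuous_attains_inf[of "{0..L}" "\<lambda>x. \<bar>F (x, y1)\<bar>"] \<open>0 \<le> L\<close> by auto
  define m where "m = \<bar>F (x0, y1)\<bar> / 2"
  have m: "m > 0" using nz[OF x0(1)] by (simp add: m_def)
  have "uniformly_continuous_on ({0..L} \<times> {a..b}) F"
    by (rule compact_uniformly_continuous[OF continuous_on_subset[OF c]]) (auto intro: compact_Times)
  then obtain e where e: "e > 0"
    "\<And>z w. z \<in> {0..L} \<times> {a..b} \<Longrightarrow> w \<in> {0..L} \<times> {a..b} \<Longrightarrow> dist w z < e \<Longrightarrow> dist (F w) (F z) < m"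
    using m unfolding uniformly_continuous_on_def by metis
  show ?thesis
  proof (rule that[of m "e / 2"])
    fix x y assume xy: "x \<in> {0..L}" "y \<in> {a..b}" "\<bar>y - y1\<bar> \<le> e / 2"
    have "dist (x, y) (x, y1) < e" using xy(3) e(1) by (simp add: dist_Pair_Pair dist_real_def)
    then have "\<bar>F (x, y) - F (x, y1)\<bar> < m" using e(2)[of "(x, y1)" "(x, y)"] xy y1 by (simp add: dist_real_def)
    moreover have "2 * m \<le> \<bar>F (x, y1)\<bar>" using x0(2)[OF xy(1)] by (simp add: m_def)
    ultimately show "m \<le> \<bar>F (x, y)\<bar>" by linarith
  qed (use m e in auto)
qed

context periodic_C2
begin

lemma fy_eq_0:
  assumes "y \<in> {-d..d}" "r > 0" "\<And>s. s \<in> {-d..d} \<Longrightarrow> \<bar>s - y\<bar> < r \<Longrightarrow> f (x, s) = 0"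
  shows "fy (x, y) = 0"
proof -
  have "((\<lambda>s. 0) has_real_derivative fy (x, y)) (at y within {-d..d})"
    by (rule has_field_derivative_transform_within[OF partial_yD[OF partials(2) assms(1) order_refl] assms(2,1)])
      (use assms(3) in \<open>simp add: dist_real_def\<close>)
  from real_derivative_unique_within_Icc[OF _ assms(1) this DERIV_const] show ?thesis using d by simp
qed

lemma eq_0_if_eq_0_on_period:
  assumes "y \<in> {-d..d}" "\<And>x. x \<in> {0..L} \<Longrightarrow> f (x, y) = 0"
  shows "f (x, y) = 0"
proof -
  obtain n where "x + of_int n * L \<in> {0..<0 + L}" by (rule period_representative[OF L])
  then show ?thesis using periodic_int(1)[OF assms(1), of x n] assms(2) by force
qed

lemma unique_continuation_one_side:
  assumes \<sigma>: "\<sigma> = 1 \<or> \<sigma> = -1" and \<rho>: "0 < \<rho>" "\<rho> \<le> 1"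
    and h: "\<And>s. s \<in> {0..\<rho>} \<Longrightarrow> y1 + \<sigma> * s \<in> {-d..d}"
    and zero: "\<And>x. f (x, y1) = 0" "\<And>x. fy (x, y1) = 0"
    and bound: "\<And>x s. x \<in> {0..L} \<Longrightarrow> s \<in> {0..\<rho>} \<Longrightarrow>
      \<bar>s * (fxx (x, y1 + \<sigma> * s) + fyy (x, y1 + \<sigma> * s))\<bar> \<le> C * \<bar>f (x, y1 + \<sigma> * s)\<bar>"
    and s: "s \<in> {0..<\<rho>}"
  shows "f (x, y1 + \<sigma> * s) = 0"
proof -
  define R where "R g = (\<lambda>(x, s). g (x, y1 + \<sigma> * s))" for g :: "real \<times> real \<Rightarrow> real"
  have \<sigma>2: "\<sigma> * (\<sigma> * t) = t" for t using \<sigma> by auto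
  have Rz: "R g (x, 0) = g (x, y1)" for g x by (simp add: R_def)
  have px: "partial_x {0..\<rho>} (R g) (R g')" if "partial_x {-d..d} g g'" for g g'
    using h that unfolding partial_x_def R_def by auto
  have py: "partial_y {0..\<rho>} (R g) (\<lambda>z. \<sigma> * R g' z)" if "partial_y {-d..d} g g'" for g g'
    unfolding partial_y_def
  proof (intro allI ballI)
    fix x t assume t: "t \<in> {0..\<rho>}"
    have 1: "((\<lambda>y. g (x, y)) has_real_derivative g' (x, y1 + \<sigma> * t)) (at (y1 + \<sigma> * t) within (\<lambda>s. y1 + \<sigma> * s) ` {0..\<rho>})"
      by (rule partial_yD[OF that h[OF t]]) (use h in auto)
    have 2: "((\<lambda>s. y1 + \<sigma> * s) has_real_derivative \<sigma>) (at t within {0..\<rho>})"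
      by (auto intro!: derivative_eq_intros)
    show "((\<lambda>s. R g (x, s)) has_real_derivative \<sigma> * R g' (x, t)) (at t within {0..\<rho>})"
      using DERIV_image_chain[OF 1 2] by (simp add: R_def o_def mult.commute)
  qed
  have cR: "continuous_on (UNIV \<times> {0..\<rho>}) (R g)" if "continuous_on (UNIV \<times> {-d..d}) g" for g
    unfolding R_def split_beta
    by (rule continuous_on_compose2[OF that]) (use h in \<open>auto intro!: continuous_intros\<close>)
  have "R f (x, s) = 0" if x: "x \<in> {0..L}" for x
  proof (rule unique_continuation_half_strip[where v = "R f" and vx = "R fx" and vy = "\<lambda>z. \<sigma> * R fy z"
        and vxx = "R fxx" and vxy = "\<lambda>z. \<sigma> * R fxy z" and vyy = "R fyy" and L = L and \<delta> = \<rho> and C = C])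
    show "partial_x {0..\<rho>} (\<lambda>z. \<sigma> * R fy z) (\<lambda>z. \<sigma> * R fxy z)"
      using px[OF partials(5)] unfolding partial_x_def by (auto intro: DERIV_cmult)
    show "partial_y {0..\<rho>} (\<lambda>z. \<sigma> * R fy z) (R fyy)"
      unfolding partial_y_def
    proof (intro allI ballI)
      fix x t assume "t \<in> {0..\<rho>}"
      from DERIV_cmult[OF partial_yD[OF py[OF partials(6)] this order_refl], of \<sigma> x]
      show "((\<lambda>s. \<sigma> * R fy (x, s)) has_real_derivative R fyy (x, t)) (at t within {0..\<rho>})"
        by (simp add: \<sigma>2)
    qed
    show "R f (L, y) = R f (0, y)" "R fx (L, y) = R fx (0, y)" "\<sigma> * R fy (L, y) = \<sigma> * R fy (0, y)"
      if "y \<in> {0..\<rho>}" for y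
      using periodic[of "y1 + \<sigma> * y" 0] h[OF that] by (simp_all add: R_def)
    show "\<bar>y * (R fxx (x, y) + R fyy (x, y))\<bar> \<le> C * \<bar>R f (x, y)\<bar>" if "x \<in> {0..L}" "y \<in> {0..\<rho>}" for x y
      using bound[OF that] by (simp add: R_def)
  qed (use L \<rho> s x zero in \<open>auto simp: Rz intro!: px py cR continuous_on_mult continuous_on_const partials cont\<close>)
  moreover have "y1 + \<sigma> * s \<in> {-d..d}" using h s by simp
  ultimately show ?thesis using eq_0_if_eq_0_on_period[of "y1 + \<sigma> * s"] by (simp add: R_def)
qed

lemma unique_continuation_near_line:
  assumes y1: "y1 \<in> {-d..d}" and zero: "\<And>x. f (x, y1) = 0" "\<And>x. fy (x, y1) = 0" and "\<delta> > 0"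
    and bound: "\<And>x y. x \<in> {0..L} \<Longrightarrow> y \<in> {-d..d} \<Longrightarrow> \<bar>y - y1\<bar> \<le> \<delta> \<Longrightarrow>
      \<bar>(y - y1) * (fxx (x, y) + fyy (x, y))\<bar> \<le> C * \<bar>f (x, y)\<bar>"
  obtains r where "r > 0" "\<And>x y. y \<in> {-d..d} \<Longrightarrow> \<bar>y - y1\<bar> < r \<Longrightarrow> f (x, y) = 0"
proof -
  have side: "\<exists>r>0. \<forall>x. \<forall>s\<in>{0..<r}. y1 + \<sigma> * s \<in> {-d..d} \<longrightarrow> f (x, y1 + \<sigma> * s) = 0"
    if \<sigma>: "\<sigma> = 1 \<or> \<sigma> = -1" for \<sigma>
  proof (cases "y1 = \<sigma> * d")
    case True
    then have "s = 0" if "s \<ge> 0" "y1 + \<sigma> * s \<in> {-d..d}" for s using that \<sigma> d by auto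
    then show ?thesis using zero by (intro exI[of _ 1]) fastforce
  next
    case False
    define \<rho> where "\<rho> = min (min \<delta> 1) (d - \<sigma> * y1)"
    have \<rho>: "0 < \<rho>" "\<rho> \<le> 1" "\<rho> \<le> \<delta>" "\<rho> \<le> d - \<sigma> * y1" using False \<sigma> y1 \<open>\<delta> > 0\<close> by (auto simp: \<rho>_def)
    have h: "y1 + \<sigma> * s \<in> {-d..d}" if "s \<in> {0..\<rho>}" for s using that \<rho> \<sigma> y1 by auto
    have "f (x, y1 + \<sigma> * s) = 0" if "s \<in> {0..<\<rho>}" for x s
    proof (rule unique_continuation_one_side[OF \<sigma> \<rho>(1,2) h zero _ that])
      fix x s assume "x \<in> {0..L}" and s: "s \<in> {0..\<rho>}"
      then show "\<bar>s * (fxx (x, y1 + \<sigma> * s) + fyy (x, y1 + \<sigma> * s))\<bar> \<le> C * \<bar>f (x, y1 + \<sigma> * s)\<bar>"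
        using bound[of x "y1 + \<sigma> * s"] h[OF s] \<rho> \<sigma> by (auto simp: abs_mult)
    qed
    then show ?thesis using \<rho>(1) by blast
  qed
  from side[of 1] obtain r1 where r1: "r1 > 0" "\<And>x s. s \<in> {0..<r1} \<Longrightarrow> y1 + s \<in> {-d..d} \<Longrightarrow> f (x, y1 + s) = 0" by auto
  from side[of "-1"] obtain r2 where r2: "r2 > 0" "\<And>x s. s \<in> {0..<r2} \<Longrightarrow> y1 - s \<in> {-d..d} \<Longrightarrow> f (x, y1 - s) = 0" by auto
  show ?thesis
  proof (rule that[of "min r1 r2"])
    show "f (x, y) = 0" if "y \<in> {-d..d}" "\<bar>y - y1\<bar> < min r1 r2" for x y
      using r1(2)[of "y - y1" x] r2(2)[of "y1 - y" x] that by (cases "y1 \<le> y") auto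
  qed (use r1 r2 in auto)
qed

end

context rayleigh
begin

lemma energy_interior:
  assumes y: "- d < y" "y < d" and neg: "U (x, y) < 0"
  shows "U (x, y) * vx (x, y) = v (x, y) * Ux (x, y)" "\<beta> * (v (x, y))\<^sup>2 = 0"
proof -
  obtain n where n: "x + of_int n * L \<in> {L / 2..<L / 2 + L}" by (rule period_representative[OF U.L])
  have "0 < x + of_int n * L" "x + of_int n * L < 2 * L" using n U.L by auto
  from rayleigh_energy(1,3)[OF this y] show "U (x, y) * vx (x, y) = v (x, y) * Ux (x, y)" "\<beta> * (v (x, y))\<^sup>2 = 0"
    using U.periodic_int(1,2)[of y x n] v.periodic_int(1,2)[of y x n] y neg by auto
qed

lemma vanish_propagates:
  assumes incompressible: "\<And>x y. y \<in> {-d..d} \<Longrightarrow> Ux (x, y) + vy (x, y) = 0"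
    and regular: "\<And>x y. y \<in> {-d..d} \<Longrightarrow> U (x, y) = 0 \<Longrightarrow> Ux (x, y) \<noteq> 0 \<or> Uy (x, y) \<noteq> 0"
    and y1: "y1 \<in> {-d..d}" and zero: "\<And>x. v (x, y1) = 0" "\<And>x. vy (x, y1) = 0"
  obtains r where "r > 0" "\<And>x y. y \<in> {-d..d} \<Longrightarrow> \<bar>y - y1\<bar> < r \<Longrightarrow> v (x, y) = 0"
proof -
  have Ux0: "Ux (x, y1) = 0" for x using incompressible[OF y1, of x] zero by simp
  have "((\<lambda>s. U (s, y1)) has_real_derivative 0) (at x)" for x
    using partial_xD[OF U.partials(1) y1, of x] by (simp add: Ux0)
  then have Uconst: "U (x, y1) = U (0, y1)" for x using DERIV_isconst_all[of "\<lambda>s. U (s, y1)"] by blast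
  have "\<exists>a>0. \<exists>\<delta>>0. \<forall>x\<in>{0..L}. \<forall>y\<in>{-d..d}. \<bar>y - y1\<bar> \<le> \<delta> \<longrightarrow> a * \<bar>y - y1\<bar> \<le> \<bar>U (x, y)\<bar>"
  proof (cases "U (0, y1) = 0")
    case False
    then have "U (x, y1) \<noteq> 0" for x using Uconst by metis
    then obtain m \<delta> where m: "m > 0" "\<delta> > 0"
      "\<And>x y. x \<in> {0..L} \<Longrightarrow> y \<in> {-d..d} \<Longrightarrow> \<bar>y - y1\<bar> \<le> \<delta> \<Longrightarrow> m \<le> \<bar>U (x, y)\<bar>"
      using bounded_below_near_line[OF U.cont(1) y1, of L] U.L by (metis less_imp_le)
    have "m * \<bar>y - y1\<bar> \<le> \<bar>U (x, y)\<bar>"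
      if "x \<in> {0..L}" "y \<in> {-d..d}" "\<bar>y - y1\<bar> \<le> min \<delta> 1" for x y
    proof -
      have "m * \<bar>y - y1\<bar> \<le> m * 1" using that m by (intro mult_left_mono) auto
      also have "\<dots> \<le> \<bar>U (x, y)\<bar>" using m(3)[OF that(1,2)] that by simp
      finally show ?thesis .
    qed
    then show ?thesis using m(1,2) by (intro exI[of _ m] conjI exI[of _ "min \<delta> 1"]) auto
  next
    case True
    then have U0: "U (x, y1) = 0" for x using Uconst[of x] by simp
    then have "Uy (x, y1) \<noteq> 0" for x using regular[OF y1, of x] Ux0 by simp
    then obtain m \<delta> where m: "m > 0" "\<delta> > 0"
      "\<And>x y. x \<in> {0..L} \<Longrightarrow> y \<in> {-d..d} \<Longrightarrow> \<bar>y - y1\<bar> \<le> \<delta> \<Longrightarrow> m \<le> \<bar>Uy (x, y)\<bar>"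
      using bounded_below_near_line[OF U.cont(3) y1, of L] U.L by (metis less_imp_le)
    have "m * \<bar>y - y1\<bar> \<le> \<bar>U (x, y)\<bar>"
      if xy: "x \<in> {0..L}" "y \<in> {-d..d}" "\<bar>y - y1\<bar> \<le> \<delta>" for x y
    proof -
      have mv: "\<exists>z\<in>{a..b}. U (x, b) - U (x, a) = (*) (Uy (x, z)) (b - a)"
        if "a \<le> b" "{a..b} \<subseteq> {-d..d}" for a b
        by (rule mvt_very_simple[OF that(1)], unfold has_field_derivative_def[symmetric])
          (rule partial_yD[OF U.partials(2) _ that(2)], use that in auto)
      have "\<exists>z. \<bar>z - y1\<bar> \<le> \<bar>y - y1\<bar> \<and> z \<in> {-d..d} \<and> \<bar>U (x, y)\<bar> = \<bar>Uy (x, z)\<bar> * \<bar>y - y1\<bar>"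
      proof (cases "y1 \<le> y")
        case True
        then obtain z where z: "z \<in> {y1..y}" "U (x, y) - U (x, y1) = (*) (Uy (x, z)) (y - y1)"
          using mv[of y1 y] y1 xy by auto
        then show ?thesis using U0 y1 xy by (intro exI[of _ z]) (auto simp: abs_mult)
      next
        case False
        then obtain z where z: "z \<in> {y..y1}" "U (x, y1) - U (x, y) = (*) (Uy (x, z)) (y1 - y)"
          using mv[of y y1] y1 xy by auto
        then have "\<bar>U (x, y)\<bar> = \<bar>Uy (x, z)\<bar> * \<bar>y - y1\<bar>"
          using U0[of x] by (metis abs_minus_cancel abs_minus_commute abs_mult diff_0)
        then show ?thesis using z(1) y1 xy by (intro exI[of _ z]) auto
      qed
      then obtain z where z: "\<bar>z - y1\<bar> \<le> \<bar>y - y1\<bar>" "z \<in> {-d..d}" "\<bar>U (x, y)\<bar> = \<bar>Uy (x, z)\<bar> * \<bar>y - y1\<bar>"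
        by blast
      have "m \<le> \<bar>Uy (x, z)\<bar>" using m(3)[OF xy(1) z(2)] z(1) xy(3) by simp
      then show ?thesis unfolding z(3) by (rule mult_right_mono) simp
    qed
    then show ?thesis using m(1,2) by blast
  qed
  then obtain a \<delta> where a: "a > 0" "\<delta> > 0"
    "\<And>x y. x \<in> {0..L} \<Longrightarrow> y \<in> {-d..d} \<Longrightarrow> \<bar>y - y1\<bar> \<le> \<delta> \<Longrightarrow> a * \<bar>y - y1\<bar> \<le> \<bar>U (x, y)\<bar>"
    by metis
  have "compact ((\<lambda>z. Uxx z + Uyy z - \<beta>) ` ({0..L} \<times> {-d..d}))"
    by (intro compact_continuous_image continuous_intros compact_Times compact_Icc
        U.cont[THEN continuous_on_subset]) auto
  then have "bounded ((\<lambda>z. Uxx z + Uyy z - \<beta>) ` ({0..L} \<times> {-d..d}))" by (rule compact_imp_bounded)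
  then obtain M where "\<forall>z\<in>{0..L} \<times> {-d..d}. \<bar>Uxx z + Uyy z - \<beta>\<bar> \<le> M"
    unfolding bounded_iff real_norm_def by auto
  then have M: "\<bar>Uxx (x, y) + Uyy (x, y) - \<beta>\<bar> \<le> M" if "x \<in> {0..L}" "y \<in> {-d..d}" for x y
    using that by blast
  show ?thesis
  proof (rule v.unique_continuation_near_line[OF y1 zero a(2)])
    fix x y assume xy: "x \<in> {0..L}" "y \<in> {-d..d}" "\<bar>y - y1\<bar> \<le> \<delta>"
    let ?D = "vxx (x, y) + vyy (x, y)"
    have "a * \<bar>y - y1\<bar> * \<bar>?D\<bar> \<le> \<bar>U (x, y)\<bar> * \<bar>?D\<bar>"
      using a(3)[OF xy] by (rule mult_right_mono) simp
    also have "\<dots> = \<bar>v (x, y)\<bar> * \<bar>Uxx (x, y) + Uyy (x, y) - \<beta>\<bar>"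
      unfolding abs_mult[symmetric] rayleigh_eq[OF xy(2)] ..
    also have "\<dots> \<le> \<bar>v (x, y)\<bar> * M" using M[OF xy(1,2)] by (rule mult_left_mono) simp
    finally show "\<bar>(y - y1) * ?D\<bar> \<le> M / a * \<bar>v (x, y)\<bar>"
      unfolding abs_mult times_divide_eq_left pos_le_divide_eq[OF a(1)] by (simp only: mult_ac)
  qed (use that in blast)
qed

lemma vanish_if_vanish_on_line:
  assumes incompressible: "\<And>x y. y \<in> {-d..d} \<Longrightarrow> Ux (x, y) + vy (x, y) = 0"
    and regular: "\<And>x y. y \<in> {-d..d} \<Longrightarrow> U (x, y) = 0 \<Longrightarrow> Ux (x, y) \<noteq> 0 \<or> Uy (x, y) \<noteq> 0"
    and y1: "y1 \<in> {-d..d}" and zero: "\<And>x. v (x, y1) = 0" "\<And>x. vy (x, y1) = 0"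
    and y: "y \<in> {-d..d}"
  shows "v (x, y) = 0"
proof -
  define Z where "Z = {y \<in> {-d..d}. \<forall>x. v (x, y) = 0 \<and> vy (x, y) = 0}"
  have "Z = {-d..d} \<inter> (\<Inter>x. {y \<in> {-d..d}. v (x, y) = 0} \<inter> {y \<in> {-d..d}. vy (x, y) = 0})"
    by (auto simp: Z_def)
  also have "closedin (top_of_set {-d..d}) \<dots>"
    by (intro closedin_Int closedin_INT closedin_subtopology_refl[THEN iffD2] continuous_closedin_preimage_constant
        continuous_on_slice_y[OF v.cont(1)] continuous_on_slice_y[OF v.cont(3)]) auto
  finally have cl: "closedin (top_of_set {-d..d}) Z" .
  have op: "openin (top_of_set {-d..d}) Z"
    unfolding openin_euclidean_subtopology_iff
  proof (intro conjI ballI)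
    fix z assume z: "z \<in> Z"
    have z1: "z \<in> {-d..d}" and z2: "\<And>x. v (x, z) = 0" "\<And>x. vy (x, z) = 0" using z by (auto simp: Z_def)
    obtain r where r: "r > 0" "\<And>x y. y \<in> {-d..d} \<Longrightarrow> \<bar>y - z\<bar> < r \<Longrightarrow> v (x, y) = 0"
      by (rule vanish_propagates[OF incompressible regular z1 z2]) blast+
    have "w \<in> Z" if w: "w \<in> {-d..d}" "dist w z < r" for w
    proof -
      have "vy (x, w) = 0" for x
        by (rule v.fy_eq_0[OF w(1), of "r - \<bar>w - z\<bar>"]) (use w r in \<open>auto simp: dist_real_def\<close>)
      then show ?thesis using r(2)[OF w(1)] w by (simp add: Z_def dist_real_def)
    qed
    then show "\<exists>e>0. \<forall>w\<in>{-d..d}. dist w z < e \<longrightarrow> w \<in> Z" using r(1) by blast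
  qed (auto simp: Z_def)
  have "connected {-d..d}" by (rule connected_Icc)
  then have "Z = {} \<or> Z = {-d..d}" using cl op unfolding connected_clopen by blast
  moreover have "y1 \<in> Z" using y1 zero by (simp add: Z_def)
  ultimately show ?thesis using y by (auto simp: Z_def)
qed

lemma vanish_of_beta_pos:
  assumes incompressible: "\<And>x y. y \<in> {-d..d} \<Longrightarrow> Ux (x, y) + vy (x, y) = 0"
    and regular: "\<And>x y. y \<in> {-d..d} \<Longrightarrow> U (x, y) = 0 \<Longrightarrow> Ux (x, y) \<noteq> 0 \<or> Uy (x, y) \<noteq> 0"
    and "\<beta> > 0" and y1: "- d < y1" "y1 < d" and neg: "U (x1, y1) < 0"
    and y: "y \<in> {-d..d}"
  shows "v (x, y) = 0"
proof -
  have y1': "y1 \<in> {-d..d}" using y1 by simp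
  have v0: "v (x, y) = 0" if "- d < y" "y < d" "U (x, y) < 0" for x y
    using energy_interior(2)[OF that] \<open>\<beta> > 0\<close> by simp
  have vy0: "vy (x, y1) = 0" if "U (x, y1) < 0" for x
  proof -
    have "\<exists>e>0. \<forall>s\<in>{-d..d}. dist s y1 < e \<longrightarrow> dist (U (x, s)) (U (x, y1)) < - U (x, y1)"
      using continuous_on_slice_y[OF U.cont(1), of "{-d..d}" x] y1' that unfolding continuous_on_iff by fastforce
    then obtain e where e: "e > 0" "\<And>s. s \<in> {-d..d} \<Longrightarrow> \<bar>s - y1\<bar> < e \<Longrightarrow> U (x, s) < 0"
      unfolding dist_real_def by (smt (verit))
    show ?thesis
    proof (rule v.fy_eq_0[OF y1', of "min e (min (d - y1) (d + y1))"])
      show "v (x, s) = 0" if "s \<in> {-d..d}" "\<bar>s - y1\<bar> < min e (min (d - y1) (d + y1))" for s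
        using v0[of s x] e(2)[of s] that by auto
    qed (use e y1 in auto)
  qed
  have "((\<lambda>s. (min (U (s, y1)) 0) ^ 3) has_real_derivative 0) (at x)" for x
  proof -
    have "3 * (min (U (x, y1)) 0)\<^sup>2 * Ux (x, y1) = 0"
      using vy0[of x] incompressible[OF y1', of x] by (cases "U (x, y1) < 0") auto
    then show ?thesis
      by (rule DERIV_cong[OF DERIV_chain2[OF DERIV_min_cube partial_xD[OF U.partials(1) y1']]])
  qed
  then have "(min (U (x, y1)) 0) ^ 3 = (min (U (x1, y1)) 0) ^ 3" for x
    using DERIV_isconst_all[of "\<lambda>s. (min (U (s, y1)) 0) ^ 3"] by blast
  note const = this
  have neg': "U (x, y1) < 0" for x
  proof (rule ccontr)
    assume "\<not> U (x, y1) < 0"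
    then have "min (U (x, y1)) 0 = 0" "min (U (x1, y1)) 0 = U (x1, y1)" using neg by auto
    then show False using const[of x] neg by simp
  qed
  show ?thesis
    by (rule vanish_if_vanish_on_line[OF incompressible regular y1' v0[OF y1 neg'] vy0[OF neg'] y])
qed

lemma vanish_of_beta_zero:
  assumes incompressible: "\<And>x y. y \<in> {-d..d} \<Longrightarrow> Ux (x, y) + vy (x, y) = 0"
    and "\<beta> = 0" and y: "y \<in> {-d..d}"
  shows "v (x, y) = 0"
proof -
  have neg: "partial_x I (\<lambda>z. - f z) (\<lambda>z. - f' z)" if "partial_x I f f'" for I f f'
    using that unfolding partial_x_def by (auto intro: DERIV_minus)
  have neg': "partial_y I (\<lambda>z. - f z) (\<lambda>z. - f' z)" if "partial_y I f f'" for I f f'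
    using that unfolding partial_y_def by (auto intro: DERIV_minus)
  interpret N: rayleigh L d "\<lambda>z. - U z" "\<lambda>z. - Ux z" "\<lambda>z. - Uy z" "\<lambda>z. - Uxx z" "\<lambda>z. - Uxy z" "\<lambda>z. - Uyy z"
    v vx vy vxx vxy vyy \<beta>
  proof unfold_locales
    show "- U (x, y) * (vxx (x, y) + vyy (x, y)) = v (x, y) * (- Uxx (x, y) + - Uyy (x, y) - \<beta>)"
      if "y \<in> {-d..d}" for x y
      using rayleigh_eq[OF that, of x] \<open>\<beta> = 0\<close> by (simp add: algebra_simps)
    show "\<beta> - (- Uxx (x, y) + - Uyy (x, y)) \<noteq> 0" if "y \<in> {-d..d}" "- U (x, y) = 0" for x y
      using noncritical[OF that(1), of x] that(2) \<open>\<beta> = 0\<close> by simp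
  qed (use U.L U.d \<open>\<beta> = 0\<close> U.periodic wall in
      \<open>auto intro!: neg neg' U.partials U.cont continuous_on_minus\<close>)
  have slope: "U (x, y) * vx (x, y) = v (x, y) * Ux (x, y)" if "- d < y" "y < d" for x y
  proof (cases "U (x, y)" "0::real" rule: linorder_cases)
    case less
    then show ?thesis by (rule energy_interior(1)[OF that])
  next
    case greater
    then show ?thesis using N.energy_interior(1)[OF that, of x] by simp
  next
    case equal
    then have "v (x, y) = 0" using rayleigh_eq[of y x] noncritical[of y x] that by simp
    then show ?thesis using equal by simp
  qed
  have wall_vx: "vx (x, y) = 0" if "y \<in> {-d..d}" "\<And>x. v (x, y) = 0" for x y
    using DERIV_unique[OF partial_xD[OF v.partials(1) that(1), of x UNIV], of 0] that(2) by simp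
  have zero: "(Ux (x, y) * v (x, y) + vx (x, y) * U (x, y)) + 2 * v (x, y) * vy (x, y) = 0"
    if y: "y \<in> {-d..d}" for x y
  proof (cases "y = d \<or> y = -d")
    case True
    then have "\<And>x. v (x, y) = 0" using wall by auto
    then show ?thesis using wall_vx[OF y] by simp
  next
    case False
    then have "U (x, y) * vx (x, y) = v (x, y) * Ux (x, y)" using y by (intro slope) auto
    moreover have "vy (x, y) = - Ux (x, y)" using incompressible[OF y, of x] by simp
    ultimately show ?thesis by (simp add: algebra_simps)
  qed
  define H where "H y = integral {0..L} (\<lambda>x. (v (x, y))\<^sup>2)" for y
  have px: "partial_x {-d..d} (\<lambda>z. U z * v z) (\<lambda>z. Ux z * v z + vx z * U z)"
    unfolding partial_x_def using partial_xD[OF U.partials(1)] partial_xD[OF v.partials(1)]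
    by (auto intro!: DERIV_mult)
  have py: "partial_y {-d..d} (\<lambda>z. (v z)\<^sup>2) (\<lambda>z. 2 * v z * vy z)"
    unfolding partial_y_def
    by (intro allI ballI, rule DERIV_cong[OF DERIV_power[OF partial_yD[OF v.partials(2) _ order_refl]]]) auto
  have H': "(H has_real_derivative 0) (at t within {-d..d})" if t: "t \<in> {-d..d}" for t
  proof -
    have "((\<lambda>y. integral {0..L} (\<lambda>x. (v (x, y))\<^sup>2)) has_real_derivative
      integral {0..L} (\<lambda>x. (Ux (x, t) * v (x, t) + vx (x, t) * U (x, t)) + 2 * v (x, t) * vy (x, t))) (at t within {-d..d})"
      using U.L U.periodic[of _ 0] v.periodic[of _ 0]
      by (intro flux_derivative[OF _ px py _ _ _ t]) (auto intro!: continuous_intros v.cont)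
    then show ?thesis unfolding H_def zero[OF t] by simp
  qed
  have "((\<lambda>_. 0) has_integral H y - H (-d)) {-d..y}"
    by (rule integral_derivative_eq, use y in simp, rule has_field_derivative_subset[OF H'])
      (use y in auto)
  then have "H y = H (-d)" by (simp add: has_integral_0_eq)
  also have "\<dots> = 0" by (simp add: H_def wall)
  finally have H0: "H y = 0" .
  have "\<forall>x\<in>{0..L}. (v (x, y))\<^sup>2 = 0"
    using H0 U.L unfolding H_def
    by (subst (asm) integral_eq_0_iff) (auto intro!: continuous_intros continuous_on_slice_x[OF v.cont(1) y])
  then show ?thesis using v.eq_0_if_eq_0_on_period[OF y, of x] by simp
qed

end

subsection \<open>Traveling waves\<close>

lemma periodic_C2_of_Ck_DL:
  assumes "L > 0" "d > 0" and f: "Ck_DL L d 2 f"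
  shows "periodic_C2 L d f (dx d f) (dy d f) (dx d (dx d f)) (dy d (dx d f)) (dy d (dy d f))"
proof -
  have f2: "Ck_DL L d (Suc (Suc 0)) f" using f by (simp add: numeral_2_eq_2)
  note f1 = Ck_DL_Suc_D[OF assms(2) f2]
  note f0 = Ck_DL_Suc_D[OF assms(2) f1(1)] Ck_DL_Suc_D[OF assms(2) f1(2)]
  have diff: "g differentiable_on strip d" if "Ck_DL L d (Suc k) g" for g k
    using that by (simp add: Ck_DL_def)
  have cont: "continuous_on (UNIV \<times> {-d..d}) g" if "Ck_DL L d k g" for g k
    using that Ck_strip_continuous unfolding Ck_DL_def by blast
  have per: "g (x + L, y) = g (x, y)" if "Ck_DL L d k g" "y \<in> {-d..d}" for g k x y
    using that by (auto simp: Ck_DL_def x_periodic_def strip_def)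
  note p = strip_partials[OF assms(2) diff[OF f2]] strip_partials[OF assms(2) diff[OF f1(1)]]
    strip_partials[OF assms(2) diff[OF f1(2)]]
  have mixed: "dy d (dx d f) (x, y) = dx d (dy d f) (x, y)" if "y \<in> {-d..d}" for x y
    using assms(2) by (intro mixed_partials_eq[OF _ p(1,2,4,5) cont[OF f1(2)] cont[OF f0(2)] cont[OF f0(3)] that]) simp
  show ?thesis
  proof
    show "partial_x {-d..d} (dy d f) (dy d (dx d f))"
      using p(5) mixed by (simp add: partial_x_def)
  qed (use assms(1,2) p cont[OF f2] cont[OF f1(1)] cont[OF f1(2)] cont[OF f0(1)] cont[OF f0(2)] cont[OF f0(4)]
      per[OF f2] per[OF f1(1)] per[OF f1(2)] in auto)
qed

lemma deriv_traveling:
  assumes "partial_x {-d..d} f f'" "y \<in> {-d..d}"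
  shows "deriv (\<lambda>s. traveling c f s (x, y)) 0 = - c * f' (x, y)"
proof -
  have "((\<lambda>s. f (x - c * s, y)) has_real_derivative f' (x - c * 0, y) * - c) (at 0)"
    by (rule DERIV_chain2[OF partial_xD[OF assms]]) (auto intro!: derivative_eq_intros)
  then show ?thesis by (simp add: traveling_def DERIV_imp_deriv)
qed

lemma traveling_wave_rayleigh:
  assumes "L > 0" "d > 0" and u: "Ck_DL L d 2 u" and v: "Ck_DL L d 2 v"
    and sol: "beta_plane_solution L d \<beta> (traveling c u) (traveling c v)" and y: "y \<in> {-d..d}"
  shows "dx d u (x, y) + dy d v (x, y) = 0"
    and "(u (x, y) - c) * laplacian d v (x, y) = v (x, y) * (laplacian d u (x, y) - \<beta>)"
proof -
  interpret u: periodic_C2 L d u "dx d u" "dy d u" "dx d (dx d u)" "dy d (dx d u)" "dy d (dy d u)"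
    by (rule periodic_C2_of_Ck_DL[OF assms(1,2) u])
  interpret v: periodic_C2 L d v "dx d v" "dy d v" "dx d (dx d v)" "dy d (dx d v)" "dy d (dy d v)"
    by (rule periodic_C2_of_Ck_DL[OF assms(1,2) v])
  have t0: "traveling c f 0 = f" for f by (auto simp: traveling_def)
  obtain P where P: "Ck_DL L d 1 (P (0::real))"
    and eqs: "\<forall>t. \<forall>(x, y)\<in>strip d.
           deriv (\<lambda>s. traveling c u s (x, y)) t + traveling c u t (x, y) * dx d (traveling c u t) (x, y)
             + traveling c v t (x, y) * dy d (traveling c u t) (x, y)
             - \<beta> * y * traveling c v t (x, y) = - dx d (P t) (x, y) \<and>
           deriv (\<lambda>s. traveling c v s (x, y)) t + traveling c u t (x, y) * dx d (traveling c v t) (x, y)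
             + traveling c v t (x, y) * dy d (traveling c v t) (x, y)
             + \<beta> * y * traveling c u t (x, y) = - dy d (P t) (x, y) \<and>
           dx d (traveling c u t) (x, y) + dy d (traveling c v t) (x, y) = 0"
    using sol unfolding beta_plane_solution_def
    by (elim conjE exE) (rule that, erule spec, assumption)
  have inc: "dx d u (x, y) + dy d v (x, y) = 0" if "y \<in> {-d..d}" for x y
    using spec[OF eqs, of 0] that by (auto simp: strip_def t0)
  then show "dx d u (x, y) + dy d v (x, y) = 0" using y .
  define A where "A = (\<lambda>(x, y). - ((u (x, y) - c) * dx d u (x, y) + v (x, y) * dy d u (x, y) - \<beta> * y * v (x, y)))"
  define B where "B = (\<lambda>(x, y). - ((u (x, y) - c) * dx d v (x, y) + v (x, y) * dy d v (x, y) + \<beta> * y * u (x, y)))"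
  define A' where "A' = (\<lambda>(x, y). - (dy d u (x, y) * dx d u (x, y) + (u (x, y) - c) * dy d (dx d u) (x, y)
      + (dy d v (x, y) * dy d u (x, y) + v (x, y) * dy d (dy d u) (x, y)) - \<beta> * (v (x, y) + y * dy d v (x, y))))"
  define B' where "B' = (\<lambda>(x, y). - (dx d u (x, y) * dx d v (x, y) + (u (x, y) - c) * dx d (dx d v) (x, y)
      + (dx d v (x, y) * dy d v (x, y) + v (x, y) * dy d (dx d v) (x, y)) + \<beta> * y * dx d u (x, y)))"
  have PA: "dx d (P 0) (x, y) = A (x, y)" and PB: "dy d (P 0) (x, y) = B (x, y)" if "y \<in> {-d..d}" for x y
  proof -
    have "(x, y) \<in> strip d" using that by (simp add: strip_def)
    note e = bspec[OF spec[OF eqs, of 0] this, unfolded split_conv t0 deriv_traveling[OF u.partials(1) that]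
        deriv_traveling[OF v.partials(1) that]]
    show "dx d (P 0) (x, y) = A (x, y)" "dy d (P 0) (x, y) = B (x, y)"
      using e unfolding A_def B_def split_conv by (simp_all add: algebra_simps)
  qed
  have "P 0 differentiable_on strip d" using P by (simp add: Ck_DL_def)
  note p = strip_partials[OF \<open>d > 0\<close> this]
  have pP: "partial_x {-d..d} (P 0) A" "partial_y {-d..d} (P 0) B"
    using p PA PB by (simp_all add: partial_x_def partial_y_def)
  have pA: "partial_y {-d..d} A A'"
    unfolding partial_y_def
  proof (intro allI ballI)
    fix x y assume y: "y \<in> {-d..d}"
    show "((\<lambda>s. A (x, s)) has_real_derivative A' (x, y)) (at y within {-d..d})"
      unfolding A_def A'_def split_conv
      by (rule derivative_eq_intros partial_yD[OF u.partials(2) y order_refl] partial_yD[OF u.partials(4) y order_refl]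
          partial_yD[OF u.partials(6) y order_refl] partial_yD[OF v.partials(2) y order_refl] refl)+
        (simp add: algebra_simps)
  qed
  have pB: "partial_x {-d..d} B B'"
    unfolding partial_x_def
  proof (intro allI ballI)
    fix x y assume y: "y \<in> {-d..d}"
    show "((\<lambda>s. B (s, y)) has_real_derivative B' (x, y)) (at x)"
      unfolding B_def B'_def split_conv
      by (rule derivative_eq_intros partial_xD[OF u.partials(1) y] partial_xD[OF v.partials(1) y]
          partial_xD[OF v.partials(3) y] partial_xD[OF v.partials(5) y] refl)+
        (simp add: algebra_simps)
  qed
  have "A' (x, y) = B' (x, y)"
  proof (rule mixed_partials_eq[OF _ pP pA pB _ _ _ y])
    show "continuous_on (UNIV \<times> {-d..d}) B" "continuous_on (UNIV \<times> {-d..d}) A'" "continuous_on (UNIV \<times> {-d..d}) B'"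
      unfolding B_def A'_def B'_def split_beta prod.collapse
      by (intro continuous_intros u.cont v.cont)+
  qed (use \<open>d > 0\<close> in simp)
  moreover have "dx d (dx d u) (x, y) = - dy d (dx d v) (x, y)"
  proof (rule DERIV_unique)
    show "((\<lambda>s. dx d u (s, y)) has_real_derivative dx d (dx d u) (x, y)) (at x)"
      by (rule partial_xD[OF u.partials(3) y])
    have "dx d u (s, y) = - dy d v (s, y)" for s using inc[OF y, of s] by simp
    then show "((\<lambda>s. dx d u (s, y)) has_real_derivative - dy d (dx d v) (x, y)) (at x)"
      using DERIV_minus[OF partial_xD[OF v.partials(5) y]] by simp
  qed
  moreover have "dy d (dx d u) (x, y) = - dy d (dy d v) (x, y)"
  proof (rule real_derivative_unique_within_Icc[OF _ y partial_yD[OF u.partials(4) y order_refl]])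
    show "((\<lambda>s. dx d u (x, s)) has_real_derivative - dy d (dy d v) (x, y)) (at y within {-d..d})"
    proof (rule has_field_derivative_transform_within[OF _ zero_less_one y])
      show "((\<lambda>s. - dy d v (x, s)) has_real_derivative - dy d (dy d v) (x, y)) (at y within {-d..d})"
        by (rule DERIV_minus[OF partial_yD[OF v.partials(6) y order_refl]])
      show "- dy d v (x, s) = dx d u (x, s)" if "s \<in> {-d..d}" for s
        using inc[OF that, of x] by simp
    qed
  qed (use \<open>d > 0\<close> in simp)
  moreover have "dx d u (x, y) = - dy d v (x, y)" using inc[OF y, of x] by simp
  ultimately show "(u (x, y) - c) * laplacian d v (x, y) = v (x, y) * (laplacian d u (x, y) - \<beta>)"
    unfolding A'_def B'_def laplacian_def by (simp add: algebra_simps)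
qed

theorem theorem3p1:
  fixes L d \<beta> c :: real and u v :: "real \<times> real \<Rightarrow> real"
  assumes "L > 0" and "d > 0" and "\<beta> \<ge> 0"
    and "Ck_DL L d 2 u" and "Ck_DL L d 2 v"
    and "beta_plane_solution L d \<beta> (traveling c u) (traveling c v)"
    and "\<forall>z\<in>strip d. u z = c \<longrightarrow> \<beta> - laplacian d u z \<noteq> 0"
    and "(\<beta> > 0 \<and> c \<in> {u_min d u<..<u_max d u} \<and> (\<forall>z\<in>strip d. u z = c \<longrightarrow> grad d u z \<noteq> 0))
       \<or> (\<beta> = 0 \<and> c \<in> Ran d u)"
  shows "shear_flow d (traveling c u) (traveling c v)"
proof -
  note waves = traveling_wave_rayleigh[OF assms(1,2,4-6)]
  interpret u: periodic_C2 L d u "dx d u" "dy d u" "dx d (dx d u)" "dy d (dx d u)" "dy d (dy d u)"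
    by (rule periodic_C2_of_Ck_DL[OF assms(1,2,4)])
  interpret v: periodic_C2 L d v "dx d v" "dy d v" "dx d (dx d v)" "dy d (dx d v)" "dy d (dy d v)"
    by (rule periodic_C2_of_Ck_DL[OF assms(1,2,5)])
  interpret rayleigh L d "\<lambda>z. u z - c" "dx d u" "dy d u" "dx d (dx d u)" "dy d (dx d u)" "dy d (dy d u)"
    v "dx d v" "dy d v" "dx d (dx d v)" "dy d (dx d v)" "dy d (dy d v)" \<beta>
  proof
    show "partial_x {-d..d} (\<lambda>z. u z - c) (dx d u)"
      unfolding partial_x_def
      by (intro allI ballI) (use DERIV_diff[OF partial_xD[OF u.partials(1)] DERIV_const] in force)
    show "partial_y {-d..d} (\<lambda>z. u z - c) (dy d u)"
      unfolding partial_y_def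
      by (intro allI ballI) (use DERIV_diff[OF partial_yD[OF u.partials(2) _ order_refl] DERIV_const] in force)
    show "(u (x, y) - c) * (dx d (dx d v) (x, y) + dy d (dy d v) (x, y))
        = v (x, y) * (dx d (dx d u) (x, y) + dy d (dy d u) (x, y) - \<beta>)" if "y \<in> {-d..d}" for x y
      using waves(2)[OF that] by (simp add: laplacian_def)
    show "\<beta> - (dx d (dx d u) (x, y) + dy d (dy d u) (x, y)) \<noteq> 0"
      if "y \<in> {-d..d}" "u (x, y) - c = 0" for x y
      using bspec[OF assms(7), of "(x, y)"] that by (simp add: laplacian_def strip_def)
    have "traveling c v 0 (x, d) = 0 \<and> traveling c v 0 (x, - d) = 0" for x
      using assms(6) unfolding beta_plane_solution_def by blast
    then show "v (x, d) = 0" "v (x, - d) = 0" for x by (simp_all add: traveling_def)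
  qed (use assms(1-3) u.partials u.cont u.periodic in \<open>auto intro!: continuous_intros\<close>)
  have "v (x, y) = 0" if y: "y \<in> {-d..d}" for x y
    using assms(8)
  proof
    assume "\<beta> = 0 \<and> c \<in> Ran d u"
    then show ?thesis using waves(1) y by (intro vanish_of_beta_zero) auto
  next
    assume i: "\<beta> > 0 \<and> c \<in> {u_min d u<..<u_max d u} \<and> (\<forall>z\<in>strip d. u z = c \<longrightarrow> grad d u z \<noteq> 0)"
    have "\<exists>x y. y \<in> {-d<..<d} \<and> u (x, y) < c"
    proof (rule ccontr)
      assume neg: "\<not> ?thesis"
      have cl: "closure {-d<..<d} = {-d..d}" using assms(2) by simp
      have ge: "c \<le> u (x, y)" if "y \<in> {-d<..<d}" for x y using neg that by (meson not_le)
      have "c \<le> u (x, y)" if "y \<in> {-d..d}" for x y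
        by (rule continuous_ge_on_closure[of "{-d<..<d}" "\<lambda>y. u (x, y)", OF _ _ ge], unfold cl)
          (use that in \<open>auto intro!: continuous_on_slice_y[OF u.cont(1)]\<close>)
      then have "c \<le> u_min d u"
        unfolding u_min_def using assms(2) by (intro cINF_greatest) (auto simp: strip_def)
      then show False using i by simp
    qed
    then obtain x1 y1 where "- d < y1" "y1 < d" "u (x1, y1) - c < 0" by auto
    then show ?thesis
    proof (intro vanish_of_beta_pos[OF waves(1) _ _ _ _ _ y])
      show "dx d u (x, y) \<noteq> 0 \<or> dy d u (x, y) \<noteq> 0" if "y \<in> {-d..d}" "u (x, y) - c = 0" for x y
      proof -
        have "grad d u (x, y) \<noteq> 0" using i that by (auto simp: strip_def)
        then show ?thesis by (simp add: grad_def zero_prod_def)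
      qed
    qed (use i in auto)
  qed
  then show ?thesis by (auto simp: shear_flow_def traveling_def strip_def)
qed

end
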